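(* Let $C=(C_1,C_0,d,c,e)$ be a reflexive graph in a semi-abelian category. Then the following three conditions are equivalent: (1) $C$ is star-multiplicative; (2) $C$ is Peiffer; (3) $\ker d$ and $\ker c$ commute (in the sense of Huq).
   Context: A pointed category (one with a zero object) is (Bourn) protomodular when it is finitely complete and the Split Short Five Lemma holds: given split epimorphisms $f\colon A\to B$ with section $s$ and $f'\colon A'\to B'$ with section $s'$, with kernels $\ker f\colon K[f]\to A$ and $\ker f'\colon K[f']\to A'$, and morphisms $k\colon K[f]\to K[f']$, $a\colon A\to A'$, $b\colon B\to B'$ with $a\ker f=\ker f'\,k$, $bf=f'a$, $s'b=as$, if $k$ and $b$ are isomorphisms then so is $a$. A category is Barr exact when it is regular (finitely complete, with pullback-stable regular epimorphisms and coequalisers of kernel pairs) and every internal equivalence relation is a kernel pair. A category is semi-abelian when it is pointed, protomodular, Barr exact and has binary coproducts. A reflexive graph $C=(C_1,C_0,d,c,e)$ consists of morphisms $d,c\colon C_1\to C_0$ and $e\colon C_0\to C_1$ with $de=ce=1_{C_0}$. Let $k=\ker d\colon X\to C_1$ and $h=ck\colon X\to C_0$. Star-multiplicative: let $C_1\times_{C_0}X$, with projections $\pi_0$ to $C_1$ and $\pi_1$ to $X$, be the pullback of $d$ and $h$ (so $d\pi_0=h\pi_1$). The graph $C$ is star-multiplicative when there is a (necessarily unique) morphism $\varsigma\colon C_1\times_{C_0}X\to X$ such that $\varsigma\langle k,0\rangle=1_X$ and $\varsigma\langle eck,1_X\rangle=1_X$. Peiffer: the graph $C$ is Peiffer when there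 is a (necessarily unique) morphism $\omega\colon X\times X\to C_1$ such that $\omega\langle 1_X,0\rangle=k$ and $\omega\langle 1_X,1_X\rangle=eck$. Huq commutation: two morphisms $k\colon X\to A$ and $l\colon Y\to A$ commute in the sense of Huq when there is a (necessarily unique) morphism $\varphi\colon X\times Y\to A$ with $\varphi\langle 1_X,0\rangle=k$ and $\varphi\langle 0,1_Y\rangle=l$. *)

theory Defs
  imports Main
begin

text \<open>
  One-sorted arrows with explicit domain and codomain. The fields are total functions; composition
  \<open>g \<cdot> f\<close> is constrained only when \<open>Cod f = Dom g\<close>.
\<close>

record ('o, 'm) cat =
  Obj :: "'o set"
  Arr :: "'m set"
  Dom :: "'m \<Rightarrow> 'o"
  Cod :: "'m \<Rightarrow> 'o"
  Id :: "'o \<Rightarrow> 'm" ("\<one>\<index>")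
  Comp :: "'m \<Rightarrow> 'm \<Rightarrow> 'm" (infixr "\<cdot>\<index>" 70)

definition homset :: "('o, 'm, 'x) cat_scheme \<Rightarrow> 'o \<Rightarrow> 'o \<Rightarrow> 'm set" ("hom\<index>")
  where "homset C A B = {f \<in> Arr C. Dom C f = A \<and> Cod C f = B}"

locale category =
  fixes C :: "('o, 'm, 'x) cat_scheme" (structure)
  assumes Dom_in: "f \<in> Arr C \<Longrightarrow> Dom C f \<in> Obj C"
    and Cod_in: "f \<in> Arr C \<Longrightarrow> Cod C f \<in> Obj C"
    and Id_in: "A \<in> Obj C \<Longrightarrow> \<one> A \<in> hom A A"
    and Comp_in: "f \<in> hom A B \<Longrightarrow> g \<in> hom B D \<Longrightarrow> g \<cdot> f \<in> hom A D"
    and Id_right: "f \<in> hom A B \<Longrightarrow> f \<cdot> \<one> A = f"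
    and Id_left: "f \<in> hom A B \<Longrightarrow> \<one> B \<cdot> f = f"
    and Comp_assoc:
      "f \<in> hom A B \<Longrightarrow> g \<in> hom B D \<Longrightarrow> h \<in> hom D E \<Longrightarrow> (h \<cdot> g) \<cdot> f = h \<cdot> (g \<cdot> f)"

definition is_iso :: "('o, 'm, 'x) cat_scheme \<Rightarrow> 'm \<Rightarrow> bool"
  where "is_iso C f \<longleftrightarrow> f \<in> Arr C \<and>
    (\<exists>g \<in> hom (Cod C f) (Dom C f). g \<cdot> f = \<one> (Dom C f) \<and> f \<cdot> g = \<one> (Cod C f))"
  for C (structure)


subsection \<open>Finite limits\<close>

definition is_functor ::
    "('i, 'j, 'y) cat_scheme \<Rightarrow> ('o, 'm, 'x) cat_scheme \<Rightarrow> ('i \<Rightarrow> 'o) \<Rightarrow> ('j \<Rightarrow> 'm) \<Rightarrow> bool"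
  where "is_functor J C F\<^sub>0 F\<^sub>1 \<longleftrightarrow>
    (\<forall>i \<in> Obj J. F\<^sub>0 i \<in> Obj C \<and> F\<^sub>1 (\<one>\<^bsub>J\<^esub> i) = \<one>\<^bsub>C\<^esub> (F\<^sub>0 i)) \<and>
    (\<forall>a \<in> Arr J. F\<^sub>1 a \<in> hom\<^bsub>C\<^esub> (F\<^sub>0 (Dom J a)) (F\<^sub>0 (Cod J a))) \<and>
    (\<forall>a \<in> Arr J. \<forall>b \<in> Arr J. Dom J b = Cod J a \<longrightarrow> F\<^sub>1 (b \<cdot>\<^bsub>J\<^esub> a) = F\<^sub>1 b \<cdot>\<^bsub>C\<^esub> F\<^sub>1 a)"

definition is_cone ::
    "('i, 'j, 'y) cat_scheme \<Rightarrow> ('o, 'm, 'x) cat_scheme \<Rightarrow> ('i \<Rightarrow> 'o) \<Rightarrow> ('j \<Rightarrow> 'm) \<Rightarrow>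
      'o \<Rightarrow> ('i \<Rightarrow> 'm) \<Rightarrow> bool"
  where "is_cone J C F\<^sub>0 F\<^sub>1 L \<pi> \<longleftrightarrow>
    L \<in> Obj C \<and> (\<forall>i \<in> Obj J. \<pi> i \<in> hom\<^bsub>C\<^esub> L (F\<^sub>0 i)) \<and>
    (\<forall>a \<in> Arr J. F\<^sub>1 a \<cdot>\<^bsub>C\<^esub> \<pi> (Dom J a) = \<pi> (Cod J a))"

definition is_limit ::
    "('i, 'j, 'y) cat_scheme \<Rightarrow> ('o, 'm, 'x) cat_scheme \<Rightarrow> ('i \<Rightarrow> 'o) \<Rightarrow> ('j \<Rightarrow> 'm) \<Rightarrow>
      'o \<Rightarrow> ('i \<Rightarrow> 'm) \<Rightarrow> bool"
  where "is_limit J C F\<^sub>0 F\<^sub>1 L \<pi> \<longleftrightarrow>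
    is_cone J C F\<^sub>0 F\<^sub>1 L \<pi> \<and>
    (\<forall>T \<tau>. is_cone J C F\<^sub>0 F\<^sub>1 T \<tau> \<longrightarrow>
      (\<exists>!u. u \<in> hom\<^bsub>C\<^esub> T L \<and> (\<forall>i \<in> Obj J. \<pi> i \<cdot>\<^bsub>C\<^esub> u = \<tau> i)))"

text \<open>
  Every finite category is isomorphic to one whose objects and arrows are natural numbers, so
  quantifying over index categories of type \<open>(nat, nat) cat\<close> covers all finite diagrams.
\<close>

locale finitely_complete_category = category +
  assumes finite_limits:
    "\<And>(J :: (nat, nat) cat) F\<^sub>0 F\<^sub>1.
      category J \<Longrightarrow> finite (Obj J) \<Longrightarrow> finite (Arr J) \<Longrightarrow> is_functor J C F\<^sub>0 F\<^sub>1 \<Longrightarrow>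
      \<exists>L \<pi>. is_limit J C F\<^sub>0 F\<^sub>1 L \<pi>"

definition is_product :: "('o, 'm, 'x) cat_scheme \<Rightarrow> 'o \<Rightarrow> 'o \<Rightarrow> 'o \<Rightarrow> 'm \<Rightarrow> 'm \<Rightarrow> bool"
  where "is_product C A B P p q \<longleftrightarrow>
    p \<in> hom P A \<and> q \<in> hom P B \<and>
    (\<forall>T. \<forall>u \<in> hom T A. \<forall>v \<in> hom T B. \<exists>!w. w \<in> hom T P \<and> p \<cdot> w = u \<and> q \<cdot> w = v)"
  for C (structure)

definition is_coproduct :: "('o, 'm, 'x) cat_scheme \<Rightarrow> 'o \<Rightarrow> 'o \<Rightarrow> 'o \<Rightarrow> 'm \<Rightarrow> 'm \<Rightarrow> bool"
  where "is_coproduct C A B S i j \<longleftrightarrow>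
    i \<in> hom A S \<and> j \<in> hom B S \<and>
    (\<forall>T. \<forall>u \<in> hom A T. \<forall>v \<in> hom B T. \<exists>!w. w \<in> hom S T \<and> w \<cdot> i = u \<and> w \<cdot> j = v)"
  for C (structure)

definition is_pullback :: "('o, 'm, 'x) cat_scheme \<Rightarrow> 'm \<Rightarrow> 'm \<Rightarrow> 'o \<Rightarrow> 'm \<Rightarrow> 'm \<Rightarrow> bool"
  where "is_pullback C f g P p q \<longleftrightarrow>
    f \<in> Arr C \<and> g \<in> Arr C \<and> Cod C f = Cod C g \<and>
    p \<in> hom P (Dom C f) \<and> q \<in> hom P (Dom C g) \<and> f \<cdot> p = g \<cdot> q \<and>
    (\<forall>T. \<forall>u \<in> hom T (Dom C f). \<forall>v \<in> hom T (Dom C g). f \<cdot> u = g \<cdot> v \<longrightarrow>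
      (\<exists>!w. w \<in> hom T P \<and> p \<cdot> w = u \<and> q \<cdot> w = v))"
  for C (structure)

text \<open>
  The morphism \<open>\<langle>u, v\<rangle>\<close> into a product or pullback with projections \<open>p\<close> and \<open>q\<close>. It is meaningful
  only when \<open>u\<close>, \<open>v\<close> form a cone over the diagram in question.
\<close>

definition pairing :: "('o, 'm, 'x) cat_scheme \<Rightarrow> 'm \<Rightarrow> 'm \<Rightarrow> 'm \<Rightarrow> 'm \<Rightarrow> 'm"
  where "pairing C p q u v =
    (THE w. w \<in> hom (Dom C u) (Dom C p) \<and> p \<cdot> w = u \<and> q \<cdot> w = v)"
  for C (structure)


subsection \<open>Pointed and protomodular categories\<close>

definition zero_object :: "('o, 'm, 'x) cat_scheme \<Rightarrow> 'o \<Rightarrow> bool"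
  where "zero_object C Z \<longleftrightarrow>
    Z \<in> Obj C \<and> (\<forall>A \<in> Obj C. (\<exists>!f. f \<in> hom A Z) \<and> (\<exists>!f. f \<in> hom Z A))"
  for C (structure)

definition zero_arrow :: "('o, 'm, 'x) cat_scheme \<Rightarrow> 'o \<Rightarrow> 'o \<Rightarrow> 'm" ("\<zero>\<index>")
  where "zero_arrow C A B =
    (THE f. \<exists>Z. zero_object C Z \<and> (\<exists>g \<in> hom A Z. \<exists>h \<in> hom Z B. f = h \<cdot> g))"
  for C (structure)

locale pointed_category = category +
  assumes zero_object_exists: "\<exists>Z. zero_object C Z"

definition is_kernel :: "('o, 'm, 'x) cat_scheme \<Rightarrow> 'm \<Rightarrow> 'o \<Rightarrow> 'm \<Rightarrow> bool"
  where "is_kernel C f K k \<longleftrightarrow>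
    f \<in> Arr C \<and> k \<in> hom K (Dom C f) \<and> f \<cdot> k = \<zero> K (Cod C f) \<and>
    (\<forall>T. \<forall>u \<in> hom T (Dom C f). f \<cdot> u = \<zero> T (Cod C f) \<longrightarrow>
      (\<exists>!w. w \<in> hom T K \<and> k \<cdot> w = u))"
  for C (structure)

locale pointed_protomodular_category = pointed_category C + finitely_complete_category C
  for C :: "('o, 'm, 'x) cat_scheme" (structure) +
  assumes split_short_five:
    "\<lbrakk> f \<in> hom A B; s \<in> hom B A; f \<cdot> s = \<one> B; is_kernel C f K i;
       f' \<in> hom A' B'; s' \<in> hom B' A'; f' \<cdot> s' = \<one> B'; is_kernel C f' K' i';
       k \<in> hom K K'; a \<in> hom A A'; b \<in> hom B B';
       a \<cdot> i = i' \<cdot> k; b \<cdot> f = f' \<cdot> a; s' \<cdot> b = a \<cdot> s;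
       is_iso C k; is_iso C b \<rbrakk> \<Longrightarrow> is_iso C a"


subsection \<open>Regular and Barr exact categories\<close>

definition is_coequaliser :: "('o, 'm, 'x) cat_scheme \<Rightarrow> 'm \<Rightarrow> 'm \<Rightarrow> 'm \<Rightarrow> bool"
  where "is_coequaliser C r s q \<longleftrightarrow>
    r \<in> Arr C \<and> s \<in> hom (Dom C r) (Cod C r) \<and>
    q \<in> Arr C \<and> Dom C q = Cod C r \<and> q \<cdot> r = q \<cdot> s \<and>
    (\<forall>T. \<forall>u \<in> hom (Cod C r) T. u \<cdot> r = u \<cdot> s \<longrightarrow>
      (\<exists>!w. w \<in> hom (Cod C q) T \<and> w \<cdot> q = u))"
  for C (structure)

definition regular_epi :: "('o, 'm, 'x) cat_scheme \<Rightarrow> 'm \<Rightarrow> bool"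
  where "regular_epi C q \<longleftrightarrow> (\<exists>r s. is_coequaliser C r s q)"

definition is_kernel_pair :: "('o, 'm, 'x) cat_scheme \<Rightarrow> 'm \<Rightarrow> 'o \<Rightarrow> 'm \<Rightarrow> 'm \<Rightarrow> bool"
  where "is_kernel_pair C f R r\<^sub>1 r\<^sub>2 \<longleftrightarrow> is_pullback C f f R r\<^sub>1 r\<^sub>2"

locale regular_category = finitely_complete_category +
  assumes kernel_pair_coequaliser: "is_kernel_pair C f R r\<^sub>1 r\<^sub>2 \<Longrightarrow> \<exists>q. is_coequaliser C r\<^sub>1 r\<^sub>2 q"
    and regular_epi_stable: "regular_epi C f \<Longrightarrow> is_pullback C f g P p q \<Longrightarrow> regular_epi C q"

definition internal_equivalence_relation ::
    "('o, 'm, 'x) cat_scheme \<Rightarrow> 'o \<Rightarrow> 'o \<Rightarrow> 'm \<Rightarrow> 'm \<Rightarrow> bool"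
  where "internal_equivalence_relation C A R r\<^sub>1 r\<^sub>2 \<longleftrightarrow>
    r\<^sub>1 \<in> hom R A \<and> r\<^sub>2 \<in> hom R A \<and>
    (\<forall>T. \<forall>u \<in> hom T R. \<forall>v \<in> hom T R. r\<^sub>1 \<cdot> u = r\<^sub>1 \<cdot> v \<and> r\<^sub>2 \<cdot> u = r\<^sub>2 \<cdot> v \<longrightarrow> u = v) \<and>
    (\<exists>\<rho> \<in> hom A R. r\<^sub>1 \<cdot> \<rho> = \<one> A \<and> r\<^sub>2 \<cdot> \<rho> = \<one> A) \<and>
    (\<exists>\<sigma> \<in> hom R R. r\<^sub>1 \<cdot> \<sigma> = r\<^sub>2 \<and> r\<^sub>2 \<cdot> \<sigma> = r\<^sub>1) \<and>
    (\<exists>P p q. is_pullback C r\<^sub>2 r\<^sub>1 P p q \<and>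
      (\<exists>\<tau> \<in> hom P R. r\<^sub>1 \<cdot> \<tau> = r\<^sub>1 \<cdot> p \<and> r\<^sub>2 \<cdot> \<tau> = r\<^sub>2 \<cdot> q))"
  for C (structure)

locale barr_exact_category = regular_category +
  assumes effective_equivalence_relations:
    "internal_equivalence_relation C A R r\<^sub>1 r\<^sub>2 \<Longrightarrow>
      \<exists>B. \<exists>f \<in> hom A B. is_kernel_pair C f R r\<^sub>1 r\<^sub>2"

locale semi_abelian_category = pointed_protomodular_category C + barr_exact_category C
  for C :: "('o, 'm, 'x) cat_scheme" (structure) +
  assumes binary_coproducts:
    "A \<in> Obj C \<Longrightarrow> B \<in> Obj C \<Longrightarrow> \<exists>S i j. is_coproduct C A B S i j"


subsection \<open>Reflexive graphs\<close>

definition reflexive_graph ::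
    "('o, 'm, 'x) cat_scheme \<Rightarrow> 'o \<Rightarrow> 'o \<Rightarrow> 'm \<Rightarrow> 'm \<Rightarrow> 'm \<Rightarrow> bool"
  where "reflexive_graph C C\<^sub>1 C\<^sub>0 d c e \<longleftrightarrow>
    d \<in> hom C\<^sub>1 C\<^sub>0 \<and> c \<in> hom C\<^sub>1 C\<^sub>0 \<and> e \<in> hom C\<^sub>0 C\<^sub>1 \<and>
    d \<cdot> e = \<one> C\<^sub>0 \<and> c \<cdot> e = \<one> C\<^sub>0"
  for C (structure)

text \<open>
  In the next two definitions \<open>k : X \<rightarrow> C\<^sub>1\<close> is meant to be a kernel of \<open>d\<close>. Here and in the
  definition of Huq commutation the pullback or product is determined up to isomorphism, and so the
  conditions do not depend on which one is taken.
\<close>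

definition star_multiplicative ::
    "('o, 'm, 'x) cat_scheme \<Rightarrow> 'm \<Rightarrow> 'm \<Rightarrow> 'm \<Rightarrow> 'o \<Rightarrow> 'm \<Rightarrow> bool"
  where "star_multiplicative C d c e X k \<longleftrightarrow>
    (\<exists>P \<pi>\<^sub>0 \<pi>\<^sub>1. is_pullback C d (c \<cdot> k) P \<pi>\<^sub>0 \<pi>\<^sub>1 \<and>
      (\<exists>\<sigma> \<in> hom P X.
        \<sigma> \<cdot> pairing C \<pi>\<^sub>0 \<pi>\<^sub>1 k (\<zero> X X) = \<one> X \<and>
        \<sigma> \<cdot> pairing C \<pi>\<^sub>0 \<pi>\<^sub>1 (e \<cdot> c \<cdot> k) (\<one> X) = \<one> X))"
  for C (structure)

definition peiffer ::
    "('o, 'm, 'x) cat_scheme \<Rightarrow> 'o \<Rightarrow> 'm \<Rightarrow> 'm \<Rightarrow> 'o \<Rightarrow> 'm \<Rightarrow> bool"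
  where "peiffer C C\<^sub>1 c e X k \<longleftrightarrow>
    (\<exists>P p q. is_product C X X P p q \<and>
      (\<exists>\<omega> \<in> hom P C\<^sub>1.
        \<omega> \<cdot> pairing C p q (\<one> X) (\<zero> X X) = k \<and>
        \<omega> \<cdot> pairing C p q (\<one> X) (\<one> X) = e \<cdot> c \<cdot> k))"
  for C (structure)

definition huq_commute ::
    "('o, 'm, 'x) cat_scheme \<Rightarrow> 'o \<Rightarrow> 'o \<Rightarrow> 'o \<Rightarrow> 'm \<Rightarrow> 'm \<Rightarrow> bool"
  where "huq_commute C X Y A k l \<longleftrightarrow>
    k \<in> hom X A \<and> l \<in> hom Y A \<and>
    (\<exists>P p q. is_product C X Y P p q \<and>
      (\<exists>\<phi> \<in> hom P A.
        \<phi> \<cdot> pairing C p q (\<one> X) (\<zero> X Y) = k \<and>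
        \<phi> \<cdot> pairing C p q (\<zero> Y X) (\<one> Y) = l))"
  for C (structure)

end

theory Submission
  imports Defs
begin

text \<open>
  Every equivalence comes from comparing split extensions: an arrow between two of them that is
  the identity on the common kernel and on the common base is invertible
  (\<open>split_extension_comparison_iso\<close>).  In particular the kernel and the section of a split
  extension are jointly epic, so two arrows out of \<open>X \<times> X\<close> are equal once they agree on
  \<open>\<langle>1, 0\<rangle>\<close> and \<open>\<langle>1, 1\<rangle>\<close>, or on \<open>\<langle>1, 0\<rangle>\<close> and \<open>\<langle>0, 1\<rangle>\<close>.

  Star-multiplicative versus Peiffer: both \<open>C\<^sub>1 \<times>\<^bsub>C\<^sub>0\<^esub> X\<close> and \<open>X \<times> X\<close> are split extensions of \<open>X\<close> by
  \<open>X\<close>, with sections \<open>\<langle>e c k, 1\<rangle>\<close> and \<open>\<langle>1, 1\<rangle>\<close>.  A star-multiplication \<open>\<sigma>\<close> gives the comparison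
  \<open>\<langle>\<sigma>, \<pi>\<^sub>1\<rangle>\<close> from the first to the second, and a Peiffer structure \<open>\<omega>\<close> gives the comparison
  \<open>\<langle>\<omega>, \<pi>\<^sub>1\<rangle>\<close> in the other direction.  Each is invertible, and its inverse yields the other structure.

  Huq commutation implies Peiffer: if \<open>\<phi> : X \<times> Y \<rightarrow> C\<^sub>1\<close> shows that \<open>k\<close> and \<open>l\<close> commute, then
  \<open>\<langle>\<phi>, \<pi>\<^sub>0\<rangle>\<close> identifies \<open>X \<times> Y\<close> with the pullback of \<open>c\<close> and \<open>c k\<close>.  The section \<open>\<langle>e c k, 1\<rangle>\<close> of
  that pullback corresponds to some \<open>\<langle>1, t\<rangle>\<close>, and \<open>\<omega> = \<phi> (1 \<times> t)\<close>.

  Peiffer implies Huq commutation: since \<open>c \<omega> = c k \<pi>\<^sub>0\<close>, there is \<open>t : X \<rightarrow> Y\<close> with \<open>l t = \<omega> \<langle>0, 1\<rangle>\<close>, and it suffices that \<open>t\<close> is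
  invertible, for then \<open>\<phi> = \<omega> (1 \<times> t\<inverse>)\<close>.  Now \<open>d l t = c k\<close>.  On the kernel of \<open>c k\<close> the arrow
  \<open>t\<close> is the negation of an abelian structure, hence an isomorphism onto the kernel of \<open>d l\<close>
  (\<open>peiffer_kernel_of_dl\<close>).  Comparing split extensions again, the pullbacks of \<open>c k\<close> and of
  \<open>d l\<close> along \<open>c k\<close> are isomorphic through \<open>t\<close>, which makes \<open>t\<close> monic.  Finally \<open>c k\<close> and
  \<open>d l\<close> have the same image in \<open>C\<^sub>0\<close>, in the form of \<open>dl_locally_factors_through_ck\<close>; so a
  regular epimorphism onto \<open>Y\<close> factors through \<open>t\<close>.
\<close>

section \<open>Arrows, zero arrows and finite limits\<close>

context category
begin

lemma homD:
  assumes "f \<in> hom A B"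
  shows "f \<in> Arr C" and "Dom C f = A" and "Cod C f = B" and "A \<in> Obj C" and "B \<in> Obj C"
  using assms Dom_in Cod_in by (auto simp: homset_def)

lemma homI: "f \<in> Arr C \<Longrightarrow> Dom C f = A \<Longrightarrow> Cod C f = B \<Longrightarrow> f \<in> hom A B"
  by (simp add: homset_def)

lemma Id_typing [simp]:
  assumes "A \<in> Obj C"
  shows "\<one> A \<in> Arr C" and "Dom C (\<one> A) = A" and "Cod C (\<one> A) = A"
  using homD[OF Id_in[OF assms]] by simp_all

lemma Comp_typing [simp]:
  assumes "f \<in> Arr C" "g \<in> Arr C" "Cod C f = Dom C g"
  shows "g \<cdot> f \<in> Arr C" and "Dom C (g \<cdot> f) = Dom C f" and "Cod C (g \<cdot> f) = Cod C g"
  using Comp_in[of f "Dom C f" "Cod C f" g "Cod C g"] assms by (auto simp: homset_def)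

lemma Id_laws [simp]:
  shows "f \<in> Arr C \<Longrightarrow> Dom C f = A \<Longrightarrow> f \<cdot> \<one> A = f"
    and "f \<in> Arr C \<Longrightarrow> Cod C f = A \<Longrightarrow> \<one> A \<cdot> f = f"
  using Id_right Id_left by (auto simp: homset_def)

lemma Comp_assoc_typing [simp]:
  assumes "f \<in> Arr C" "g \<in> Arr C" "h \<in> Arr C" "Cod C f = Dom C g" "Cod C g = Dom C h"
  shows "(h \<cdot> g) \<cdot> f = h \<cdot> (g \<cdot> f)"
  using Comp_assoc[of f "Dom C f" "Dom C g" g "Dom C h" h "Cod C h"] assms by (auto simp: homset_def)

text \<open>
  Composites are normalised by association to the right; this turns a known equation between
  arrows into the rewrite rule that applies inside such a composite.
\<close>

lemma Comp_extend:
  assumes "g \<cdot> f = h" "g \<in> Arr C" "f \<in> Arr C" "Cod C f = Dom C g" "x \<in> Arr C" "Cod C x = Dom C f"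
  shows "g \<cdot> (f \<cdot> x) = h \<cdot> x"
  using assms Comp_assoc_typing by metis

lemma Comp_extend3:
  assumes "h \<cdot> g \<cdot> f = y" "f \<in> Arr C" "g \<in> Arr C" "h \<in> Arr C" "Cod C f = Dom C g" "Cod C g = Dom C h"
    and "x \<in> Arr C" "Cod C x = Dom C f"
  shows "h \<cdot> g \<cdot> f \<cdot> x = y \<cdot> x"
  unfolding assms(1)[symmetric] using assms(2-) by simp

lemma isoE:
  assumes "is_iso C f" "f \<in> hom A B"
  obtains g where "g \<in> hom B A" "g \<cdot> f = \<one> A" "f \<cdot> g = \<one> B"
  using assms by (auto simp: is_iso_def homset_def)

lemma isoI: "f \<in> hom A B \<Longrightarrow> g \<in> hom B A \<Longrightarrow> g \<cdot> f = \<one> A \<Longrightarrow> f \<cdot> g = \<one> B \<Longrightarrow> is_iso C f"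
  by (auto simp: is_iso_def homset_def)

lemma iso_Id: "A \<in> Obj C \<Longrightarrow> is_iso C (\<one> A)"
  by (rule isoI[of _ A A "\<one> A"]) (auto intro: Id_in)

lemma pullbackD:
  assumes "is_pullback C f g P p q" "f \<in> hom A B" "g \<in> hom A' B'"
  shows "p \<in> hom P A" and "q \<in> hom P A'" and "f \<cdot> p = g \<cdot> q" and "B' = B"
  using assms homD[OF assms(2)] homD[OF assms(3)] unfolding is_pullback_def by auto

lemma pullback_pair:
  assumes "is_pullback C f g P p q" "f \<in> hom A B" "g \<in> hom A' B"
    and "u \<in> hom T A" "v \<in> hom T A'" "f \<cdot> u = g \<cdot> v"
  obtains w where "w \<in> hom T P" "p \<cdot> w = u" "q \<cdot> w = v"
  using assms unfolding is_pullback_def by (metis homD(2))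

lemma pullback_unique:
  assumes "is_pullback C f g P p q"
    and "w \<in> hom T P" "w' \<in> hom T P" "p \<cdot> w = p \<cdot> w'" "q \<cdot> w = q \<cdot> w'"
  shows "w = w'"
proof -
  have p: "p \<in> hom P (Dom C f)" "q \<in> hom P (Dom C g)" "f \<cdot> p = g \<cdot> q" "f \<in> Arr C" "g \<in> Arr C"
    using assms(1) unfolding is_pullback_def by auto
  have "f \<cdot> (p \<cdot> w) = g \<cdot> (q \<cdot> w)"
    using p Comp_assoc_typing[of w p f] Comp_assoc_typing[of w q g]
      homD[OF p(1)] homD[OF p(2)] homD[OF assms(2)] by simp
  moreover have "p \<cdot> w \<in> hom T (Dom C f)" "q \<cdot> w \<in> hom T (Dom C g)"
    using p assms(2) Comp_in by blast+
  ultimately show ?thesis using assms unfolding is_pullback_def by metis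
qed

lemma productD:
  assumes "is_product C A B P p q"
  shows "p \<in> hom P A" and "q \<in> hom P B"
  using assms unfolding is_product_def by auto

lemma product_pair:
  assumes "is_product C A B P p q" "u \<in> hom T A" "v \<in> hom T B"
  obtains w where "w \<in> hom T P" "p \<cdot> w = u" "q \<cdot> w = v"
  using assms unfolding is_product_def by metis

lemma product_unique:
  assumes "is_product C A B P p q"
    and "w \<in> hom T P" "w' \<in> hom T P" "p \<cdot> w = p \<cdot> w'" "q \<cdot> w = q \<cdot> w'"
  shows "w = w'"
proof -
  have "p \<cdot> w \<in> hom T A" "q \<cdot> w \<in> hom T B"
    using productD[OF assms(1)] assms(2) Comp_in by blast+
  then show ?thesis using assms unfolding is_product_def by metis
qed

lemma product_sym: "is_product C A B P p q \<Longrightarrow> is_product C B A P q p"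
  unfolding is_product_def by metis

lemma pairing_pullback:
  assumes "is_pullback C f g P p q" "w \<in> hom T P"
  shows "pairing C p q (p \<cdot> w) (q \<cdot> w) = w"
proof -
  have p: "p \<in> hom P (Dom C f)" using assms(1) unfolding is_pullback_def by auto
  have "Dom C (p \<cdot> w) = T" "Dom C p = P" using homD[OF p] homD[OF assms(2)] by simp_all
  then show ?thesis unfolding pairing_def
    using pullback_unique[OF assms(1)] assms(2) by (intro the_equality) auto
qed

lemma pairing_product:
  assumes "is_product C A B P p q" "w \<in> hom T P"
  shows "pairing C p q (p \<cdot> w) (q \<cdot> w) = w"
proof -
  have "Dom C (p \<cdot> w) = T" "Dom C p = P"
    using homD[OF productD(1)[OF assms(1)]] homD[OF assms(2)] by simp_all
  then show ?thesis unfolding pairing_def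
    using product_unique[OF assms(1)] assms(2) by (intro the_equality) auto
qed

definition monic :: "'m \<Rightarrow> bool" where
  "monic m \<longleftrightarrow> m \<in> Arr C \<and>
    (\<forall>T. \<forall>u \<in> hom T (Dom C m). \<forall>v \<in> hom T (Dom C m). m \<cdot> u = m \<cdot> v \<longrightarrow> u = v)"

lemma monicD: "monic m \<Longrightarrow> m \<in> hom A B \<Longrightarrow> u \<in> hom T A \<Longrightarrow> v \<in> hom T A \<Longrightarrow> m \<cdot> u = m \<cdot> v \<Longrightarrow> u = v"
  unfolding monic_def using homD(2) by metis

lemma coequaliser_factor:
  assumes "is_coequaliser C r s q" "r \<in> hom R A" "q \<in> hom A I" "u \<in> hom A T" "u \<cdot> r = u \<cdot> s"
  obtains w where "w \<in> hom I T" "w \<cdot> q = u"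
  using assms homD[OF assms(2)] homD[OF assms(3)] unfolding is_coequaliser_def by metis

lemma regular_epi_epic:
  assumes "regular_epi C q" "q \<in> hom A B" "u \<in> hom B T" "v \<in> hom B T" "u \<cdot> q = v \<cdot> q"
  shows "u = v"
proof -
  obtain r s where rs: "is_coequaliser C r s q" using assms(1) by (auto simp: regular_epi_def)
  note [simp] = homD[OF assms(2)] homD[OF assms(3)] homD[OF assms(4)]
  have [simp]: "r \<in> Arr C" "s \<in> Arr C" "Cod C r = A" "Cod C s = A" "Dom C s = Dom C r"
    and qr: "q \<cdot> r = q \<cdot> s"
    using rs by (auto simp: is_coequaliser_def homset_def)
  have "(u \<cdot> q) \<cdot> r = (u \<cdot> q) \<cdot> s" by (simp add: qr)
  then have "\<exists>!w. w \<in> hom B T \<and> w \<cdot> q = u \<cdot> q"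
    using rs unfolding is_coequaliser_def by (simp add: homI)
  then show ?thesis using assms by metis
qed

lemma monic_regular_epi_iso:
  assumes "monic m" "m \<in> hom A B" "r \<in> hom V A" "regular_epi C (m \<cdot> r)"
  shows "is_iso C m"
proof -
  note [simp] = homD[OF assms(2)] homD[OF assms(3)]
  obtain a b where ab: "is_coequaliser C a b (m \<cdot> r)"
    using assms(4) by (auto simp: regular_epi_def)
  have [simp]: "a \<in> Arr C" "b \<in> Arr C" "Cod C a = V" "Cod C b = V" "Dom C b = Dom C a"
    and eq: "m \<cdot> r \<cdot> a = m \<cdot> r \<cdot> b"
    using ab by (auto simp: is_coequaliser_def homset_def)
  have "r \<cdot> a = r \<cdot> b"
    by (rule monicD[OF assms(1,2) _ _ eq, of "Dom C a"]) (auto intro: homI)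
  moreover have "r \<in> hom (Cod C a) A" using assms(3) by simp
  ultimately obtain w where w: "w \<in> hom B A" "w \<cdot> (m \<cdot> r) = r"
    using ab unfolding is_coequaliser_def by (metis Comp_typing(3) homD(1-3) assms(2,3))
  note [simp] = homD[OF w(1)]
  have mw: "m \<cdot> w = \<one> B"
    by (rule regular_epi_epic[OF assms(4), of V B _ B]) (auto intro!: homI simp: w)
  have "w \<cdot> m = \<one> A"
    by (rule monicD[OF assms(1,2), of _ A]) (auto intro!: homI simp: Comp_extend[OF mw])
  with mw show ?thesis by (intro isoI[OF assms(2) w(1)])
qed

lemma regular_epi_iso_Comp:
  assumes q: "regular_epi C q" "q \<in> hom A I" and m: "is_iso C m" "m \<in> hom I B"
  shows "regular_epi C (m \<cdot> q)"
proof -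
  obtain n where n: "n \<in> hom B I" "n \<cdot> m = \<one> I" "m \<cdot> n = \<one> B" using isoE[OF m] .
  note [simp] = homD[OF q(2)] homD[OF m(2)] homD[OF n(1)]
  obtain r s where rs: "is_coequaliser C r s q" using q unfolding regular_epi_def by blast
  then have [simp]: "r \<in> Arr C" "s \<in> Arr C" "Cod C r = A" "Cod C s = A" "Dom C s = Dom C r"
    and eq: "q \<cdot> r = q \<cdot> s"
    by (auto simp: is_coequaliser_def homset_def)
  have "is_coequaliser C r s (m \<cdot> q)"
    unfolding is_coequaliser_def
  proof (intro conjI allI ballI impI)
    fix T u assume "u \<in> hom (Cod C r) T" and ur: "u \<cdot> r = u \<cdot> s"
    then have u: "u \<in> hom A T" by simp
    note [simp] = homD[OF u]
    obtain w where w: "w \<in> hom I T" "w \<cdot> q = u"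
      by (rule coequaliser_factor[OF rs homI[OF _ refl] q(2) u ur]) simp_all
    note [simp] = homD[OF w(1)]
    show "\<exists>!w. w \<in> hom (Cod C (m \<cdot> q)) T \<and> w \<cdot> m \<cdot> q = u"
    proof (rule ex1I[of _ "w \<cdot> n"])
      show "w \<cdot> n \<in> hom (Cod C (m \<cdot> q)) T \<and> (w \<cdot> n) \<cdot> m \<cdot> q = u"
        by (auto intro!: homI simp: Comp_extend[OF n(2)] w)
      fix x assume x: "x \<in> hom (Cod C (m \<cdot> q)) T \<and> x \<cdot> m \<cdot> q = u"
      then have xh: "x \<in> hom B T" by simp
      note [simp] = homD[OF xh]
      have "x \<cdot> m = w"
        by (rule regular_epi_epic[OF q, of _ T]) (use x w in \<open>auto intro: homI\<close>)
      then show "x = w \<cdot> n"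
        using n(3) Comp_assoc[OF n(1) m(2) xh] by simp
    qed
  qed (auto intro!: homI simp: eq)
  then show ?thesis unfolding regular_epi_def by blast
qed

end

context pointed_category
begin

lemma zero_arrow_in:
  assumes "A \<in> Obj C" "B \<in> Obj C"
  shows "\<zero> A B \<in> hom A B"
    and zero_arrow_factor: "zero_object C Z \<Longrightarrow> g \<in> hom A Z \<Longrightarrow> h \<in> hom Z B \<Longrightarrow> h \<cdot> g = \<zero> A B"
proof -
  let ?Q = "\<lambda>f. \<exists>Z. zero_object C Z \<and> (\<exists>g \<in> hom A Z. \<exists>h \<in> hom Z B. f = h \<cdot> g)"
  have uniq: "f = f'" if f: "?Q f" and f': "?Q f'" for f f'
  proof -
    obtain Z g h where 1: "zero_object C Z" "g \<in> hom A Z" "h \<in> hom Z B" "f = h \<cdot> g" using f by auto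
    obtain Z' g' h' where 2: "zero_object C Z'" "g' \<in> hom A Z'" "h' \<in> hom Z' B" "f' = h' \<cdot> g'"
      using f' by auto
    obtain u where u: "u \<in> hom Z Z'" using 1 2 unfolding zero_object_def by metis
    have "u \<cdot> g = g'" using Comp_in[OF 1(2) u] 2 assms unfolding zero_object_def by metis
    moreover have "h' \<cdot> u = h" using Comp_in[OF u 2(3)] 1 assms unfolding zero_object_def by metis
    ultimately show ?thesis using Comp_assoc[OF 1(2) u 2(3)] 1 2 by simp
  qed
  obtain Z0 where Z0: "zero_object C Z0" using zero_object_exists by auto
  obtain g0 h0 where gh: "g0 \<in> hom A Z0" "h0 \<in> hom Z0 B"
    using Z0 assms unfolding zero_object_def by metis
  then have ex: "?Q (h0 \<cdot> g0)" using Z0 by auto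
  have z: "?Q (\<zero> A B)" unfolding zero_arrow_def
    by (rule theI[of ?Q, OF ex]) (rule uniq[OF _ ex])
  show "\<zero> A B \<in> hom A B" using z Comp_in by auto
  show "h \<cdot> g = \<zero> A B" if "zero_object C Z" "g \<in> hom A Z" "h \<in> hom Z B"
    using uniq[OF _ z] that by blast
qed

lemma zero_typing [simp]:
  assumes "A \<in> Obj C" "B \<in> Obj C"
  shows "\<zero> A B \<in> Arr C" and "Dom C (\<zero> A B) = A" and "Cod C (\<zero> A B) = B"
  by (rule homD[OF zero_arrow_in(1)[OF assms]])+

lemma zero_factorisation:
  assumes "A \<in> Obj C" "B \<in> Obj C"
  obtains Z g h where "zero_object C Z" "g \<in> hom A Z" "h \<in> hom Z B" "\<zero> A B = h \<cdot> g"
proof -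
  obtain Z where Z: "zero_object C Z" using zero_object_exists by auto
  then obtain g h where gh: "g \<in> hom A Z" "h \<in> hom Z B"
    using assms unfolding zero_object_def by metis
  show ?thesis by (rule that[OF Z gh zero_arrow_factor[OF assms Z gh, symmetric]])
qed

lemma zero_Comp [simp]:
  assumes "f \<in> Arr C" "Cod C f = A" "B \<in> Obj C"
  shows "\<zero> A B \<cdot> f = \<zero> (Dom C f) B"
proof -
  have f: "f \<in> hom (Dom C f) A" using assms homI by auto
  obtain Z g h where z: "zero_object C Z" "g \<in> hom A Z" "h \<in> hom Z B" "\<zero> A B = h \<cdot> g"
    using zero_factorisation[OF homD(5)[OF f] assms(3)] .
  show ?thesis
    unfolding z(4) Comp_assoc[OF f z(2,3)]
    by (rule zero_arrow_factor[OF homD(4)[OF f] assms(3) z(1) Comp_in[OF f z(2)] z(3)])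
qed

lemma Comp_zero [simp]:
  assumes "f \<in> Arr C" "Dom C f = B" "A \<in> Obj C"
  shows "f \<cdot> \<zero> A B = \<zero> A (Cod C f)"
proof -
  have f: "f \<in> hom B (Cod C f)" using assms homI by auto
  obtain Z g h where z: "zero_object C Z" "g \<in> hom A Z" "h \<in> hom Z B" "\<zero> A B = h \<cdot> g"
    using zero_factorisation[OF assms(3) homD(4)[OF f]] .
  show ?thesis
    unfolding z(4) Comp_assoc[OF z(2,3) f, symmetric]
    by (rule zero_arrow_factor[OF assms(3) homD(5)[OF f] z(1) z(2) Comp_in[OF z(3) f]])
qed

lemma kernelD:
  assumes "is_kernel C f K i" "f \<in> hom A B"
  shows "i \<in> hom K A" and "f \<cdot> i = \<zero> K B"
  using assms homD[OF assms(2)] unfolding is_kernel_def by auto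

lemma kernel_lift:
  assumes "is_kernel C f K i" "f \<in> hom A B" "u \<in> hom T A" "f \<cdot> u = \<zero> T B"
  obtains w where "w \<in> hom T K" "i \<cdot> w = u"
  using assms unfolding is_kernel_def by (metis homD(2,3))

lemma kernel_monic:
  assumes "is_kernel C f K i"
  shows "monic i"
proof -
  obtain A B where f: "f \<in> hom A B" using assms unfolding is_kernel_def by (auto intro: homI)
  note i = kernelD[OF assms f]
  note [simp] = homD[OF f] homD[OF i(1)]
  have "u = v" if "u \<in> hom T K" "v \<in> hom T K" "i \<cdot> u = i \<cdot> v" for T u v
  proof -
    note [simp] = homD[OF that(1)]
    have "i \<cdot> u \<in> hom T A" by (rule Comp_in[OF that(1) i(1)])
    moreover have "f \<cdot> (i \<cdot> u) = \<zero> T B" by (simp add: Comp_extend[OF i(2)])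
    ultimately have "\<exists>!w. w \<in> hom T K \<and> i \<cdot> w = i \<cdot> u"
      using assms unfolding is_kernel_def by simp
    then show ?thesis using that by metis
  qed
  then show ?thesis unfolding monic_def by auto
qed

lemma kernelI:
  assumes "f \<in> hom A B" "i \<in> hom K A" "f \<cdot> i = \<zero> K B" "monic i"
    and "\<And>T u. u \<in> hom T A \<Longrightarrow> f \<cdot> u = \<zero> T B \<Longrightarrow> \<exists>w \<in> hom T K. i \<cdot> w = u"
  shows "is_kernel C f K i"
  unfolding is_kernel_def using assms monicD[OF assms(4,2)] homD[OF assms(1)]
  by metis

text \<open>
  This computes the kernel of \<open>C\<^sub>1 \<times>\<^bsub>C\<^sub>0\<^esub> X \<rightarrow> X\<close> and also those of product projections, since a
  product is a pullback over the zero object.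
\<close>

lemma kernel_of_pullback:
  assumes "is_kernel C f K i" "f \<in> hom A B" "g \<in> hom B' B" "is_pullback C f g P p q"
    and "j \<in> hom K P" "p \<cdot> j = i" "q \<cdot> j = \<zero> K B'"
  shows "is_kernel C q K j"
proof (rule kernelI)
  note i = kernelD[OF assms(1,2)] and pq = pullbackD[OF assms(4,2,3)]
  note [simp] = homD[OF assms(2)] homD[OF assms(3)] homD[OF assms(5)] homD[OF i(1)]
    homD[OF pq(1)] homD[OF pq(2)]
  show "q \<in> hom P B'" "j \<in> hom K P" "q \<cdot> j = \<zero> K B'" by fact+
  have "u = v" if "u \<in> hom T K" "v \<in> hom T K" "j \<cdot> u = j \<cdot> v" for T u v
  proof -
    note [simp] = homD[OF that(1)] homD[OF that(2)]
    have "p \<cdot> (j \<cdot> u) = p \<cdot> (j \<cdot> v)" using that by simp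
    then have "i \<cdot> u = i \<cdot> v" by (simp add: Comp_extend[OF assms(6)])
    then show ?thesis using monicD[OF kernel_monic[OF assms(1)] i(1)] that by blast
  qed
  then show "monic j" unfolding monic_def by auto
  fix T u assume u: "u \<in> hom T P" and qu: "q \<cdot> u = \<zero> T B'"
  note [simp] = homD[OF u]
  have "f \<cdot> (p \<cdot> u) = \<zero> T B"
    by (simp add: Comp_extend[OF pq(3)] qu)
  then obtain w where w: "w \<in> hom T K" "i \<cdot> w = p \<cdot> u"
    by (rule kernel_lift[OF assms(1,2) Comp_in[OF u pq(1)]]) auto
  note [simp] = homD[OF w(1)]
  have "j \<cdot> w = u"
    by (rule pullback_unique[OF assms(4), of _ T])
      (auto intro!: homI simp: qu w Comp_extend[OF assms(6)] Comp_extend[OF assms(7)])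
  with w show "\<exists>w \<in> hom T K. j \<cdot> w = u" by blast
qed

lemma product_kernel:
  assumes "is_product C A B P p q"
    and "j \<in> hom A P" "p \<cdot> j = \<one> A" "q \<cdot> j = \<zero> A B"
  shows "is_kernel C q A j"
proof -
  note pq = productD[OF assms(1)]
  note [simp] = homD[OF pq(1)] homD[OF pq(2)]
  obtain Z where Z: "zero_object C Z" using zero_object_exists by auto
  then have [simp]: "Z \<in> Obj C" unfolding zero_object_def by auto
  have pb: "is_pullback C (\<zero> A Z) (\<zero> B Z) P p q"
    using assms(1) unfolding is_pullback_def is_product_def by (auto intro!: homI)
  have ker: "is_kernel C (\<zero> A Z) A (\<one> A)"
    by (rule kernelI[of _ A Z]) (auto intro!: homI simp: monic_def homset_def)
  have z: "\<zero> A Z \<in> hom A Z" "\<zero> B Z \<in> hom B Z" by (auto intro: homI)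
  show ?thesis by (rule kernel_of_pullback[OF ker z pb assms(2-4)])
qed

end

text \<open>
  The objects are \<open>0\<close>, \<open>1\<close> and \<open>2\<close>, each identity is named like its object, and the two other
  arrows are \<open>3 : 0 \<rightarrow> 2\<close> and \<open>4 : 1 \<rightarrow> 2\<close>.
\<close>

definition cospan_shape :: "(nat, nat) cat" where
  "cospan_shape = \<lparr>Obj = {0, 1, 2}, Arr = {0, 1, 2, 3, 4},
    Dom = (\<lambda>a. if a = 3 then 0 else if a = 4 then 1 else a),
    Cod = (\<lambda>a. if a \<ge> 3 then 2 else a), Id = (\<lambda>i. i),
    Comp = (\<lambda>b a. if b \<ge> 3 then b else a)\<rparr>"

lemma category_cospan_shape: "category cospan_shape"
  by unfold_locales (auto simp: cospan_shape_def homset_def split: if_splits)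

context finitely_complete_category
begin

lemma pullback_exists:
  assumes f: "f \<in> hom A B" and g: "g \<in> hom A' B"
  obtains P p q where "is_pullback C f g P p q"
proof -
  note [simp] = homD[OF f] homD[OF g]
  define F0 where "F0 = (\<lambda>i::nat. if i = 0 then A else if i = 1 then A' else B)"
  define F1 where "F1 = (\<lambda>a::nat. if a = 3 then f else if a = 4 then g else \<one> (F0 a))"
  have F: "is_functor cospan_shape C F0 F1"
    using f g by (auto simp: is_functor_def cospan_shape_def F0_def F1_def intro: homI)
  have cone: "is_cone cospan_shape C F0 F1 T \<tau> \<longleftrightarrow>
      \<tau> 0 \<in> hom T A \<and> \<tau> 1 \<in> hom T A' \<and> f \<cdot> \<tau> 0 = \<tau> 2 \<and> g \<cdot> \<tau> 1 = \<tau> 2" for T \<tau>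
  proof -
    have "\<tau> 2 \<in> hom T B" if "f \<cdot> \<tau> 0 = \<tau> 2" "\<tau> 0 \<in> hom T A"
      using Comp_in[OF that(2) f] that(1) by simp
    moreover have "T \<in> Obj C" if "\<tau> 0 \<in> hom T A" by (rule homD(4)[OF that])
    ultimately show ?thesis
      by (auto simp: is_cone_def cospan_shape_def F0_def F1_def Id_left)
  qed
  obtain L \<pi> where L: "is_limit cospan_shape C F0 F1 L \<pi>"
    using finite_limits[OF category_cospan_shape _ _ F] by (auto simp: cospan_shape_def)
  then have \<pi>: "\<pi> 0 \<in> hom L A" "\<pi> 1 \<in> hom L A'" "f \<cdot> \<pi> 0 = \<pi> 2" "g \<cdot> \<pi> 1 = \<pi> 2"
    unfolding is_limit_def cone by auto
  note [simp] = homD[OF \<pi>(1)] homD[OF \<pi>(2)]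
  have "is_pullback C f g L (\<pi> 0) (\<pi> 1)"
    unfolding is_pullback_def
  proof (intro conjI allI ballI impI)
    fix T u v assume "u \<in> hom T (Dom C f)" "v \<in> hom T (Dom C g)" and eq: "f \<cdot> u = g \<cdot> v"
    then have uv: "u \<in> hom T A" "v \<in> hom T A'" by auto
    define \<tau> where "\<tau> = (\<lambda>i::nat. if i = 0 then u else if i = 1 then v else f \<cdot> u)"
    have "is_cone cospan_shape C F0 F1 T \<tau>" unfolding cone using uv eq by (simp add: \<tau>_def)
    then have "\<exists>!w. w \<in> hom T L \<and> (\<forall>i \<in> {0, 1, 2}. \<pi> i \<cdot> w = \<tau> i)"
      using L unfolding is_limit_def by (auto simp: cospan_shape_def)
    moreover have "(\<forall>i \<in> {0, 1, 2}. \<pi> i \<cdot> w = \<tau> i) \<longleftrightarrow> \<pi> 0 \<cdot> w = u \<and> \<pi> 1 \<cdot> w = v"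
      if w: "w \<in> hom T L" for w
    proof -
      note [simp] = homD[OF w]
      show ?thesis by (auto simp: \<tau>_def \<pi>(3)[symmetric])
    qed
    ultimately show "\<exists>!w. w \<in> hom T L \<and> \<pi> 0 \<cdot> w = u \<and> \<pi> 1 \<cdot> w = v" by (metis (no_types, lifting))
  qed (use \<pi> in auto)
  then show ?thesis using that by blast
qed

end

context pointed_protomodular_category
begin

lemma product_exists:
  assumes "A \<in> Obj C" "B \<in> Obj C"
  obtains P p q where "is_product C A B P p q"
proof -
  obtain Z where Z: "zero_object C Z" using zero_object_exists by auto
  have [simp]: "A \<in> Obj C" "B \<in> Obj C" "Z \<in> Obj C" using assms Z unfolding zero_object_def by auto
  have z: "\<zero> A Z \<in> hom A Z" "\<zero> B Z \<in> hom B Z" by (auto intro: homI)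
  obtain P p q where P: "is_pullback C (\<zero> A Z) (\<zero> B Z) P p q" using pullback_exists[OF z] .
  have "is_product C A B P p q"
    unfolding is_product_def
  proof (intro conjI allI ballI)
    show "p \<in> hom P A" "q \<in> hom P B" using pullbackD[OF P z] by auto
    fix T u v assume uv: "u \<in> hom T A" "v \<in> hom T B"
    note [simp] = homD[OF uv(1)] homD[OF uv(2)]
    obtain w where "w \<in> hom T P" "p \<cdot> w = u" "q \<cdot> w = v"
      by (rule pullback_pair[OF P z uv]) auto
    then show "\<exists>!w. w \<in> hom T P \<and> p \<cdot> w = u \<and> q \<cdot> w = v"
      using pullback_unique[OF P] by metis
  qed
  then show ?thesis using that by blast
qed

lemma kernel_exists:
  assumes f: "f \<in> hom A B"
  obtains K i where "is_kernel C f K i"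
proof -
  note [simp] = homD[OF f]
  obtain Z where Z: "zero_object C Z" using zero_object_exists by auto
  then have [simp]: "Z \<in> Obj C" unfolding zero_object_def by auto
  have z: "\<zero> Z B \<in> hom Z B" by (auto intro: homI)
  have to_Z: "u = \<zero> T Z" if "u \<in> hom T Z" for u T
    using Z that homD(4)[OF that] zero_arrow_in(1)[of T Z] unfolding zero_object_def by auto
  obtain K i q where K: "is_pullback C f (\<zero> Z B) K i q" using pullback_exists[OF f z] .
  note iq = pullbackD[OF K f z]
  note [simp] = homD[OF iq(1)] homD[OF iq(2)]
  have "is_kernel C f K i"
  proof (rule kernelI[OF f iq(1)])
    show "f \<cdot> i = \<zero> K B" using iq(3) by simp
    have "u = v" if "u \<in> hom T K" "v \<in> hom T K" "i \<cdot> u = i \<cdot> v" for T u v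
      using pullback_unique[OF K that] to_Z[OF Comp_in[OF that(1) iq(2)]]
        to_Z[OF Comp_in[OF that(2) iq(2)]] by simp
    then show "monic i" unfolding monic_def by auto
    fix T u assume u: "u \<in> hom T A" "f \<cdot> u = \<zero> T B"
    note [simp] = homD[OF u(1)]
    obtain w where "w \<in> hom T K" "i \<cdot> w = u"
      by (rule pullback_pair[OF K f z u(1), of "\<zero> T Z"]) (auto intro: homI simp: u)
    then show "\<exists>w \<in> hom T K. i \<cdot> w = u" by blast
  qed
  then show ?thesis using that by blast
qed

section \<open>Split extensions\<close>

definition split_extension :: "'o \<Rightarrow> 'm \<Rightarrow> 'o \<Rightarrow> 'm \<Rightarrow> 'o \<Rightarrow> 'm \<Rightarrow> bool" where
  "split_extension K i A f B s \<longleftrightarrow>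
    f \<in> hom A B \<and> s \<in> hom B A \<and> f \<cdot> s = \<one> B \<and> is_kernel C f K i"

lemma split_extensionD:
  assumes "split_extension K i A f B s"
  shows "f \<in> hom A B" "s \<in> hom B A" "f \<cdot> s = \<one> B" "is_kernel C f K i" "i \<in> hom K A" "f \<cdot> i = \<zero> K B"
  using assms kernelD unfolding split_extension_def by auto

lemma split_extension_comparison_iso:
  assumes "split_extension K i A f B s" "split_extension K i' A' f' B s'"
    and "a \<in> hom A A'" "a \<cdot> i = i'" "f' \<cdot> a = f" "a \<cdot> s = s'"
  shows "is_iso C a"
proof -
  note 1 = split_extensionD[OF assms(1)] and 2 = split_extensionD[OF assms(2)]
  note [simp] = homD[OF 1(1)] homD[OF 1(2)] homD[OF 1(5)] homD[OF 2(1)] homD[OF 2(2)] homD[OF 2(5)]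
  show ?thesis
    by (rule split_short_five[OF 1(1-4) 2(1-4), of "\<one> K" a "\<one> B"])
      (use assms in \<open>auto intro: homI iso_Id\<close>)
qed

text \<open>
  The arrow \<open>f \<cdot> m\<close> is split by \<open>s'\<close> and still has kernel \<open>K\<close>, so \<open>m\<close> itself is a comparison of
  split extensions.
\<close>

lemma monic_through_split_extension_iso:
  assumes ext: "split_extension K i A f B s" and m: "monic m" "m \<in> hom M A"
    and i': "i' \<in> hom K M" "m \<cdot> i' = i" and s': "s' \<in> hom B M" "m \<cdot> s' = s"
  shows "is_iso C m"
proof -
  note 1 = split_extensionD[OF ext]
  note [simp] = homD[OF 1(1)] homD[OF 1(2)] homD[OF 1(5)] homD[OF m(2)] homD[OF i'(1)] homD[OF s'(1)]
  have "is_kernel C (f \<cdot> m) K i'"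
  proof (rule kernelI)
    show "f \<cdot> m \<in> hom M B" "i' \<in> hom K M" by (auto intro: homI)
    show "(f \<cdot> m) \<cdot> i' = \<zero> K B" by (simp add: i' 1)
    have "u = v" if "u \<in> hom T K" "v \<in> hom T K" "i' \<cdot> u = i' \<cdot> v" for T u v
    proof -
      note [simp] = homD[OF that(1)] homD[OF that(2)]
      have "m \<cdot> (i' \<cdot> u) = m \<cdot> (i' \<cdot> v)" using that by simp
      then have "i \<cdot> u = i \<cdot> v" by (simp add: Comp_extend[OF i'(2)])
      then show ?thesis using monicD[OF kernel_monic[OF 1(4)] 1(5)] that by blast
    qed
    then show "monic i'" unfolding monic_def by auto
    fix T u assume u: "u \<in> hom T M" "(f \<cdot> m) \<cdot> u = \<zero> T B"
    note [simp] = homD[OF u(1)]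
    obtain w where w: "w \<in> hom T K" "i \<cdot> w = m \<cdot> u"
      by (rule kernel_lift[OF 1(4,1), of "m \<cdot> u" T]) (use u in \<open>auto intro: homI\<close>)
    note [simp] = homD[OF w(1)]
    have "i' \<cdot> w = u"
      by (rule monicD[OF m, of _ T]) (auto intro: homI simp: Comp_extend[OF i'(2)] w)
    with w show "\<exists>w \<in> hom T K. i' \<cdot> w = u" by blast
  qed
  then have "split_extension K i' M (f \<cdot> m) B s'"
    unfolding split_extension_def by (auto intro!: homI simp: s' 1)
  then show ?thesis
    by (rule split_extension_comparison_iso[OF _ ext m(2) i'(2) _ s'(2)]) simp
qed

lemma split_extension_jointly_epic:
  assumes ext: "split_extension K i A f B s" and uv: "u \<in> hom A T" "v \<in> hom A T"
    and "u \<cdot> i = v \<cdot> i" "u \<cdot> s = v \<cdot> s"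
  shows "u = v"
proof -
  note 1 = split_extensionD[OF ext]
  note [simp] = homD[OF 1(1)] homD[OF 1(2)] homD[OF 1(5)] homD[OF uv(1)] homD[OF uv(2)]
  obtain P p q where P: "is_product C A T P p q" by (rule product_exists[of A T]) auto
  note pq = productD[OF P]
  note [simp] = homD[OF pq(1)] homD[OF pq(2)]
  obtain gu where gu: "gu \<in> hom A P" "p \<cdot> gu = \<one> A" "q \<cdot> gu = u"
    by (rule product_pair[OF P Id_in uv(1)]) auto
  obtain gv where gv: "gv \<in> hom A P" "p \<cdot> gv = \<one> A" "q \<cdot> gv = v"
    by (rule product_pair[OF P Id_in uv(2)]) auto
  note [simp] = homD[OF gu(1)] homD[OF gv(1)]
  note [simp] = gu(2,3) gv(2,3) Comp_extend[OF gu(2)] Comp_extend[OF gu(3)]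
    Comp_extend[OF gv(2)] Comp_extend[OF gv(3)]
  \<comment> \<open>The equaliser of \<open>u\<close> and \<open>v\<close>, as the intersection of their graphs.\<close>
  obtain E m m' where E: "is_pullback C gu gv E m m'" using pullback_exists[OF gu(1) gv(1)] .
  note m = pullbackD[OF E gu(1) gv(1)]
  note [simp] = homD[OF m(1)] homD[OF m(2)]
  have mm: "m = m'"
  proof -
    have "p \<cdot> (gu \<cdot> m) = p \<cdot> (gv \<cdot> m')" using m(3) by simp
    then show ?thesis by simp
  qed
  have um: "u \<cdot> m = v \<cdot> m"
  proof -
    have "q \<cdot> (gu \<cdot> m) = q \<cdot> (gv \<cdot> m')" using m(3) by simp
    then show ?thesis by (simp add: mm)
  qed
  have mon: "monic m"
    unfolding monic_def using pullback_unique[OF E] by (auto simp: mm[symmetric])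
  have lift: "\<exists>w \<in> hom S E. m \<cdot> w = x" if x: "x \<in> hom S A" "u \<cdot> x = v \<cdot> x" for x S
  proof -
    note [simp] = homD[OF x(1)]
    have "gu \<cdot> x = gv \<cdot> x"
      by (rule product_unique[OF P, of _ S]) (auto intro: homI simp: x)
    then show ?thesis using pullback_pair[OF E gu(1) gv(1) x(1) x(1)] by metis
  qed
  obtain i' where i': "i' \<in> hom K E" "m \<cdot> i' = i" using lift[OF 1(5)] assms by auto
  obtain s' where s': "s' \<in> hom B E" "m \<cdot> s' = s" using lift[OF 1(2)] assms by auto
  have "is_iso C m" by (rule monic_through_split_extension_iso[OF ext mon m(1) i' s'])
  then obtain n where n: "n \<in> hom A E" "m \<cdot> n = \<one> A" using isoE m(1) by metis
  note [simp] = homD[OF n(1)]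
  have "u \<cdot> (m \<cdot> n) = v \<cdot> (m \<cdot> n)" by (simp add: Comp_extend[OF um])
  then show ?thesis by (simp add: n)
qed

lemma split_extension_of_pullback:
  assumes "is_kernel C f K i" "f \<in> hom A B" "g \<in> hom B' B" "is_pullback C f g P p q"
    and "j \<in> hom K P" "p \<cdot> j = i" "q \<cdot> j = \<zero> K B'"
    and "s \<in> hom B' P" "q \<cdot> s = \<one> B'"
  shows "split_extension K j P q B' s"
  using kernel_of_pullback[OF assms(1-7)] assms(8,9) pullbackD[OF assms(4,2,3)]
  unfolding split_extension_def by blast

lemma split_extension_of_product:
  assumes "is_product C A B P p q" "j \<in> hom A P" "p \<cdot> j = \<one> A" "q \<cdot> j = \<zero> A B"
    and "s \<in> hom B P" "q \<cdot> s = \<one> B"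
  shows "split_extension A j P q B s"
  using product_kernel[OF assms(1-4)] assms(5,6) productD[OF assms(1)]
  unfolding split_extension_def by blast

text \<open>
  A subtraction satisfies \<open>(x - y) - (0 - y) = x\<close>, because both sides agree when \<open>x\<close> or \<open>y\<close>
  is zero; putting \<open>x = y\<close> gives \<open>0 - (0 - x) = x\<close>.
\<close>

lemma subtraction_negation_involutive:
  assumes P: "is_product C A A P p q" and m: "m \<in> hom P A"
    and i: "i \<in> hom A P" "p \<cdot> i = \<one> A" "q \<cdot> i = \<zero> A A" "m \<cdot> i = \<one> A"
    and \<delta>: "\<delta> \<in> hom A P" "p \<cdot> \<delta> = \<one> A" "q \<cdot> \<delta> = \<one> A" "m \<cdot> \<delta> = \<zero> A A"
    and j: "j \<in> hom A P" "p \<cdot> j = \<zero> A A" "q \<cdot> j = \<one> A"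
  shows "(m \<cdot> j) \<cdot> (m \<cdot> j) = \<one> A"
proof -
  note pq = productD[OF P]
  note [simp] = homD[OF pq(1)] homD[OF pq(2)] homD[OF m] homD[OF i(1)] homD[OF \<delta>(1)] homD[OF j(1)]
  note [simp] = i(2-) \<delta>(2-) j(2-)
  have mjq: "m \<cdot> j \<cdot> q \<in> hom P A" by (auto intro: homI)
  obtain r where r: "r \<in> hom P P" "p \<cdot> r = m" "q \<cdot> r = m \<cdot> j \<cdot> q"
    by (rule product_pair[OF P m mjq]) auto
  note [simp] = homD[OF r(1)]
  note [simp] = Comp_extend[OF r(2)] Comp_extend[OF r(3)] Comp_extend[OF i(2)] Comp_extend[OF i(3)]
    Comp_extend[OF i(4)] Comp_extend[OF \<delta>(2)] Comp_extend[OF \<delta>(3)] Comp_extend[OF j(2)]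
    Comp_extend[OF j(3)] r(2,3)
  have ri: "r \<cdot> i = i"
    by (rule product_unique[OF P, of _ A]) (auto intro: homI)
  have rj: "r \<cdot> j = \<delta> \<cdot> m \<cdot> j"
    by (rule product_unique[OF P, of _ A]) (auto intro: homI)
  have r\<delta>: "r \<cdot> \<delta> = j \<cdot> m \<cdot> j"
    by (rule product_unique[OF P, of _ A]) (auto intro: homI)
  have "split_extension A i P q A j"
    by (rule split_extension_of_product[OF P]) (use i j in auto)
  then have "m \<cdot> r = p"
    by (rule split_extension_jointly_epic[of _ _ _ _ _ _ _ A])
      (auto intro: homI simp: ri rj Comp_extend[OF \<delta>(4)])
  then have "m \<cdot> (r \<cdot> \<delta>) = p \<cdot> \<delta>" by (simp add: Comp_extend)
  then show ?thesis by (simp add: r\<delta>)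
qed

end

section \<open>Regular images\<close>

context regular_category
begin

text \<open>
  The coequaliser \<open>q\<close> of the kernel pair of \<open>f\<close> is pullback stable, so two arrows into the
  image can be lifted along \<open>q\<close> after an epimorphic change of domain; hence the comparison
  \<open>m\<close> is monic.
\<close>

lemma image_factorisation:
  assumes f: "f \<in> hom A B"
  obtains I q m where "q \<in> hom A I" "regular_epi C q" "m \<in> hom I B" "monic m" "m \<cdot> q = f"
proof -
  note [simp] = homD[OF f]
  obtain R r1 r2 where R: "is_pullback C f f R r1 r2" using pullback_exists[OF f f] .
  note r = pullbackD[OF R f f]
  note [simp] = homD[OF r(1)] homD[OF r(2)]
  obtain q where q: "is_coequaliser C r1 r2 q"
    using kernel_pair_coequaliser R unfolding is_kernel_pair_def by blast
  define I where "I = Cod C q"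
  have qh: "q \<in> hom A I" and qr: "q \<cdot> r1 = q \<cdot> r2"
    using q unfolding is_coequaliser_def I_def by (auto intro: homI)
  note [simp] = homD[OF qh]
  have qreg: "regular_epi C q" using q unfolding regular_epi_def by blast
  obtain m where m: "m \<in> hom I B" "m \<cdot> q = f"
    by (rule coequaliser_factor[OF q r(1) qh f r(3)])
  note [simp] = homD[OF m(1)]
  have "u = v" if uv: "u \<in> hom T I" "v \<in> hom T I" and eq: "m \<cdot> u = m \<cdot> v" for T u v
  proof -
    obtain P1 a1 t1 where P1: "is_pullback C q u P1 a1 t1" using pullback_exists[OF qh uv(1)] .
    note 1 = pullbackD[OF P1 qh uv(1)]
    have vt: "v \<cdot> t1 \<in> hom P1 I" using Comp_in[OF 1(2) uv(2)] .
    obtain P2 a2 t2 where P2: "is_pullback C q (v \<cdot> t1) P2 a2 t2" using pullback_exists[OF qh vt] .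
    note 2 = pullbackD[OF P2 qh vt]
    note [simp] = homD[OF uv(1)] homD[OF uv(2)] homD[OF 1(1)] homD[OF 1(2)] homD[OF 2(1)] homD[OF 2(2)]
    have q2: "q \<cdot> a2 = v \<cdot> (t1 \<cdot> t2)" using 2(3) by simp
    have q1: "q \<cdot> (a1 \<cdot> t2) = u \<cdot> (t1 \<cdot> t2)" by (simp add: Comp_extend[OF 1(3)])
    have "f \<cdot> (a1 \<cdot> t2) = f \<cdot> a2"
      by (simp add: m(2)[symmetric] q1 q2 Comp_extend[OF eq])
    then obtain w where w: "w \<in> hom P2 R" "r1 \<cdot> w = a1 \<cdot> t2" "r2 \<cdot> w = a2"
      by (rule pullback_pair[OF R f f Comp_in[OF 2(2) 1(1)] 2(1)]) auto
    note [simp] = homD[OF w(1)]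
    have "q \<cdot> (r1 \<cdot> w) = q \<cdot> (r2 \<cdot> w)" by (simp add: Comp_extend[OF qr])
    then have "u \<cdot> (t1 \<cdot> t2) = v \<cdot> (t1 \<cdot> t2)" using w q1 q2 by simp
    then have "(u \<cdot> t1) \<cdot> t2 = (v \<cdot> t1) \<cdot> t2" by simp
    then have "u \<cdot> t1 = v \<cdot> t1"
      by (rule regular_epi_epic[OF regular_epi_stable[OF qreg P2], of P2 P1 _ I, rotated -1])
        (auto intro: homI)
    then show ?thesis
      by (rule regular_epi_epic[OF regular_epi_stable[OF qreg P1], of P1 T _ I, rotated -1])
        (auto intro: homI)
  qed
  then have "monic m" unfolding monic_def by auto
  then show ?thesis using that qh qreg m by blast
qed

end

context semi_abelian_category
begin

text \<open>The image of \<open>g\<close> contains the kernel and the section, which leaves no room for a proper image.\<close>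

lemma regular_epi_through_split_extension:
  assumes ext: "split_extension K i A f B s" and g: "g \<in> hom S A"
    and i': "i' \<in> hom K S" "g \<cdot> i' = i" and s': "s' \<in> hom B S" "g \<cdot> s' = s"
  shows "regular_epi C g"
proof -
  obtain I q m where q: "q \<in> hom S I" "regular_epi C q" and m: "m \<in> hom I A" "monic m"
    and mq: "m \<cdot> q = g" using image_factorisation[OF g] .
  note [simp] = homD[OF q(1)] homD[OF m(1)] homD[OF i'(1)] homD[OF s'(1)]
  have "is_iso C m"
    by (rule monic_through_split_extension_iso[OF ext m(2,1), of "q \<cdot> i'" "q \<cdot> s'"])
      (auto intro: homI simp: Comp_extend[OF mq] i' s')
  then show ?thesis using regular_epi_iso_Comp[OF q(2,1) _ m(1)] mq by simp
qed

end

section \<open>Conditions on a reflexive graph\<close>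

locale reflexive_graph_with_kernels = semi_abelian_category C
  for C :: "('o, 'm, 'x) cat_scheme" (structure) +
  fixes C\<^sub>1 C\<^sub>0 X Y :: 'o and d c e k l :: 'm
  assumes graph: "reflexive_graph C C\<^sub>1 C\<^sub>0 d c e"
    and kernel_d: "is_kernel C d X k"
    and kernel_c: "is_kernel C c Y l"
begin

lemma graph_arrows:
  shows d: "d \<in> hom C\<^sub>1 C\<^sub>0" and c: "c \<in> hom C\<^sub>1 C\<^sub>0" and e: "e \<in> hom C\<^sub>0 C\<^sub>1"
    and k: "k \<in> hom X C\<^sub>1" and l: "l \<in> hom Y C\<^sub>1"
  using graph kernelD(1)[OF kernel_d] kernelD(1)[OF kernel_c]
  unfolding reflexive_graph_def by auto

lemma graph_equations:
  shows de: "d \<cdot> e = \<one> C\<^sub>0" and ce: "c \<cdot> e = \<one> C\<^sub>0" and dk: "d \<cdot> k = \<zero> X C\<^sub>0" and cl: "c \<cdot> l = \<zero> Y C\<^sub>0"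
  using graph kernelD(2)[OF kernel_d d] kernelD(2)[OF kernel_c c]
  unfolding reflexive_graph_def by auto

lemmas graph_typing [simp] = homD[OF d] homD[OF c] homD[OF e] homD[OF k] homD[OF l]

lemmas graph_simps [simp] = de ce dk cl
  Comp_extend[OF de] Comp_extend[OF ce] Comp_extend[OF dk] Comp_extend[OF cl]

lemma ck: "c \<cdot> k \<in> hom X C\<^sub>0" and dl: "d \<cdot> l \<in> hom Y C\<^sub>0" and eck: "e \<cdot> c \<cdot> k \<in> hom X C\<^sub>1"
  by (auto intro: homI)

lemma zero_X: "\<zero> X X \<in> hom X X" and one_X: "\<one> X \<in> hom X X"
  by (auto intro: homI)

lemma peifferE:
  assumes "peiffer C C\<^sub>1 c e X k"
  obtains P p q i \<delta> \<omega> where "is_product C X X P p q" "\<omega> \<in> hom P C\<^sub>1"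
    "i \<in> hom X P" "p \<cdot> i = \<one> X" "q \<cdot> i = \<zero> X X" "\<delta> \<in> hom X P" "p \<cdot> \<delta> = \<one> X" "q \<cdot> \<delta> = \<one> X"
    "\<omega> \<cdot> i = k" "\<omega> \<cdot> \<delta> = e \<cdot> c \<cdot> k"
proof -
  obtain P p q \<omega> where P: "is_product C X X P p q" and \<omega>: "\<omega> \<in> hom P C\<^sub>1"
    "\<omega> \<cdot> pairing C p q (\<one> X) (\<zero> X X) = k" "\<omega> \<cdot> pairing C p q (\<one> X) (\<one> X) = e \<cdot> c \<cdot> k"
    using assms unfolding peiffer_def by blast
  obtain i where i: "i \<in> hom X P" "p \<cdot> i = \<one> X" "q \<cdot> i = \<zero> X X"
    by (rule product_pair[OF P one_X zero_X])
  obtain \<delta> where \<delta>: "\<delta> \<in> hom X P" "p \<cdot> \<delta> = \<one> X" "q \<cdot> \<delta> = \<one> X"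
    by (rule product_pair[OF P one_X one_X])
  show ?thesis
    using that[OF P \<omega>(1) i \<delta>] \<omega> pairing_product[OF P i(1)] pairing_product[OF P \<delta>(1)] i \<delta> by simp
qed

lemma peifferI:
  assumes "is_product C X X P p q" "\<omega> \<in> hom P C\<^sub>1"
    and "i \<in> hom X P" "p \<cdot> i = \<one> X" "q \<cdot> i = \<zero> X X" "\<delta> \<in> hom X P" "p \<cdot> \<delta> = \<one> X" "q \<cdot> \<delta> = \<one> X"
    and "\<omega> \<cdot> i = k" "\<omega> \<cdot> \<delta> = e \<cdot> c \<cdot> k"
  shows "peiffer C C\<^sub>1 c e X k"
  unfolding peiffer_def
  using assms pairing_product[OF assms(1,3)] pairing_product[OF assms(1,6)] by force

lemma star_multiplicativeE:
  assumes "star_multiplicative C d c e X k"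
  obtains P \<pi> \<rho> i s \<sigma> where "is_pullback C d (c \<cdot> k) P \<pi> \<rho>" "\<sigma> \<in> hom P X"
    "i \<in> hom X P" "\<pi> \<cdot> i = k" "\<rho> \<cdot> i = \<zero> X X" "s \<in> hom X P" "\<pi> \<cdot> s = e \<cdot> c \<cdot> k" "\<rho> \<cdot> s = \<one> X"
    "\<sigma> \<cdot> i = \<one> X" "\<sigma> \<cdot> s = \<one> X"
proof -
  obtain P \<pi> \<rho> \<sigma> where P: "is_pullback C d (c \<cdot> k) P \<pi> \<rho>" and \<sigma>: "\<sigma> \<in> hom P X"
    "\<sigma> \<cdot> pairing C \<pi> \<rho> k (\<zero> X X) = \<one> X" "\<sigma> \<cdot> pairing C \<pi> \<rho> (e \<cdot> c \<cdot> k) (\<one> X) = \<one> X"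
    using assms unfolding star_multiplicative_def by blast
  obtain i where i: "i \<in> hom X P" "\<pi> \<cdot> i = k" "\<rho> \<cdot> i = \<zero> X X"
    by (rule pullback_pair[OF P d ck k zero_X]) auto
  obtain s where s: "s \<in> hom X P" "\<pi> \<cdot> s = e \<cdot> c \<cdot> k" "\<rho> \<cdot> s = \<one> X"
    by (rule pullback_pair[OF P d ck eck one_X]) auto
  show ?thesis
    using that[OF P \<sigma>(1) i s] \<sigma> pairing_pullback[OF P i(1)] pairing_pullback[OF P s(1)] i s by simp
qed

lemma star_multiplicativeI:
  assumes "is_pullback C d (c \<cdot> k) P \<pi> \<rho>" "\<sigma> \<in> hom P X"
    and "i \<in> hom X P" "\<pi> \<cdot> i = k" "\<rho> \<cdot> i = \<zero> X X" "s \<in> hom X P" "\<pi> \<cdot> s = e \<cdot> c \<cdot> k" "\<rho> \<cdot> s = \<one> X"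
    and "\<sigma> \<cdot> i = \<one> X" "\<sigma> \<cdot> s = \<one> X"
  shows "star_multiplicative C d c e X k"
  unfolding star_multiplicative_def
  using assms pairing_pullback[OF assms(1,3)] pairing_pullback[OF assms(1,6)] by force

lemma huq_commuteE:
  assumes "huq_commute C X Y C\<^sub>1 k l"
  obtains P p q i j \<phi> where "is_product C X Y P p q" "\<phi> \<in> hom P C\<^sub>1"
    "i \<in> hom X P" "p \<cdot> i = \<one> X" "q \<cdot> i = \<zero> X Y" "j \<in> hom Y P" "p \<cdot> j = \<zero> Y X" "q \<cdot> j = \<one> Y"
    "\<phi> \<cdot> i = k" "\<phi> \<cdot> j = l"
proof -
  obtain P p q \<phi> where P: "is_product C X Y P p q" and \<phi>: "\<phi> \<in> hom P C\<^sub>1"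
    "\<phi> \<cdot> pairing C p q (\<one> X) (\<zero> X Y) = k" "\<phi> \<cdot> pairing C p q (\<zero> Y X) (\<one> Y) = l"
    using assms unfolding huq_commute_def by blast
  have z: "\<zero> X Y \<in> hom X Y" "\<zero> Y X \<in> hom Y X" "\<one> Y \<in> hom Y Y" by (auto intro: homI)
  obtain i where i: "i \<in> hom X P" "p \<cdot> i = \<one> X" "q \<cdot> i = \<zero> X Y"
    by (rule product_pair[OF P one_X z(1)])
  obtain j where j: "j \<in> hom Y P" "p \<cdot> j = \<zero> Y X" "q \<cdot> j = \<one> Y"
    by (rule product_pair[OF P z(2,3)])
  show ?thesis
    using that[OF P \<phi>(1) i j] \<phi> pairing_product[OF P i(1)] pairing_product[OF P j(1)] i j by simp
qed

lemma huq_commuteI: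
  assumes "is_product C X Y P p q" "\<phi> \<in> hom P C\<^sub>1"
    and "i \<in> hom X P" "p \<cdot> i = \<one> X" "q \<cdot> i = \<zero> X Y" "j \<in> hom Y P" "p \<cdot> j = \<zero> Y X" "q \<cdot> j = \<one> Y"
    and "\<phi> \<cdot> i = k" "\<phi> \<cdot> j = l"
  shows "huq_commute C X Y C\<^sub>1 k l"
  unfolding huq_commute_def
  using assms k l pairing_product[OF assms(1,3)] pairing_product[OF assms(1,6)] by force

lemma star_multiplicative_imp_peiffer:
  assumes "star_multiplicative C d c e X k"
  shows "peiffer C C\<^sub>1 c e X k"
proof -
  obtain P \<pi> \<rho> i s \<sigma> where P: "is_pullback C d (c \<cdot> k) P \<pi> \<rho>" and \<sigma>: "\<sigma> \<in> hom P X"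
    and i: "i \<in> hom X P" "\<pi> \<cdot> i = k" "\<rho> \<cdot> i = \<zero> X X"
    and s: "s \<in> hom X P" "\<pi> \<cdot> s = e \<cdot> c \<cdot> k" "\<rho> \<cdot> s = \<one> X"
    and \<sigma>i: "\<sigma> \<cdot> i = \<one> X" and \<sigma>s: "\<sigma> \<cdot> s = \<one> X"
    using star_multiplicativeE[OF assms] .
  note \<pi>\<rho> = pullbackD[OF P d ck]
  obtain Q p q where Q: "is_product C X X Q p q" by (rule product_exists[of X X]) auto
  note pq = productD[OF Q]
  obtain i' where i': "i' \<in> hom X Q" "p \<cdot> i' = \<one> X" "q \<cdot> i' = \<zero> X X"
    by (rule product_pair[OF Q one_X zero_X])
  obtain \<delta> where \<delta>: "\<delta> \<in> hom X Q" "p \<cdot> \<delta> = \<one> X" "q \<cdot> \<delta> = \<one> X"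
    by (rule product_pair[OF Q one_X one_X])
  obtain a where a: "a \<in> hom P Q" "p \<cdot> a = \<sigma>" "q \<cdot> a = \<rho>"
    by (rule product_pair[OF Q \<sigma> \<pi>\<rho>(2)])
  note [simp] = homD[OF \<pi>\<rho>(1)] homD[OF \<pi>\<rho>(2)] homD[OF pq(1)] homD[OF pq(2)] homD[OF \<sigma>]
    homD[OF i(1)] homD[OF s(1)] homD[OF i'(1)] homD[OF \<delta>(1)] homD[OF a(1)]
    Comp_extend[OF a(2)] Comp_extend[OF a(3)]
  have ai: "a \<cdot> i = i'"
    by (rule product_unique[OF Q, of _ X]) (auto intro: homI simp: i i' \<sigma>i)
  have a_s: "a \<cdot> s = \<delta>"
    by (rule product_unique[OF Q, of _ X]) (auto intro: homI simp: s \<delta> \<sigma>s)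
  have "is_iso C a"
    by (rule split_extension_comparison_iso[OF split_extension_of_pullback[OF kernel_d d ck P i s(1,3)]
      split_extension_of_product[OF Q i' \<delta>(1,3)] a(1) ai a(3) a_s])
  then obtain b where b: "b \<in> hom Q P" "b \<cdot> a = \<one> P" using isoE[OF _ a(1)] by metis
  note [simp] = homD[OF b(1)]
  have "(b \<cdot> a) \<cdot> i = b \<cdot> i'" "(b \<cdot> a) \<cdot> s = b \<cdot> \<delta>" by (simp_all add: ai a_s)
  then have bi: "b \<cdot> i' = i" and bs: "b \<cdot> \<delta> = s" by (simp_all add: b(2))
  show ?thesis
    by (rule peifferI[OF Q Comp_in[OF b(1) \<pi>\<rho>(1)] i' \<delta>]) (simp_all add: bi bs i s)
qed

lemma peiffer_imp_star_multiplicative: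
  assumes "peiffer C C\<^sub>1 c e X k"
  shows "star_multiplicative C d c e X k"
proof -
  obtain Q p q i \<delta> \<omega> where Q: "is_product C X X Q p q" and \<omega>: "\<omega> \<in> hom Q C\<^sub>1"
    and i: "i \<in> hom X Q" "p \<cdot> i = \<one> X" "q \<cdot> i = \<zero> X X"
    and \<delta>: "\<delta> \<in> hom X Q" "p \<cdot> \<delta> = \<one> X" "q \<cdot> \<delta> = \<one> X"
    and \<omega>i: "\<omega> \<cdot> i = k" and \<omega>\<delta>: "\<omega> \<cdot> \<delta> = e \<cdot> c \<cdot> k"
    using peifferE[OF assms] .
  note pq = productD[OF Q]
  note ext = split_extension_of_product[OF Q i \<delta>(1,3)]
  obtain P \<pi> \<rho> where P: "is_pullback C d (c \<cdot> k) P \<pi> \<rho>" using pullback_exists[OF d ck] .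
  note \<pi>\<rho> = pullbackD[OF P d ck]
  note [simp] = homD[OF \<pi>\<rho>(1)] homD[OF \<pi>\<rho>(2)] homD[OF pq(1)] homD[OF pq(2)] homD[OF \<omega>]
    homD[OF i(1)] homD[OF \<delta>(1)]
  have d\<omega>: "d \<cdot> \<omega> = (c \<cdot> k) \<cdot> q"
    by (rule split_extension_jointly_epic[OF ext, of _ C\<^sub>0])
      (auto intro: homI simp: i \<delta> \<omega>i \<omega>\<delta>)
  obtain i' where i': "i' \<in> hom X P" "\<pi> \<cdot> i' = k" "\<rho> \<cdot> i' = \<zero> X X"
    by (rule pullback_pair[OF P d ck k zero_X]) auto
  obtain s where s: "s \<in> hom X P" "\<pi> \<cdot> s = e \<cdot> c \<cdot> k" "\<rho> \<cdot> s = \<one> X"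
    by (rule pullback_pair[OF P d ck eck one_X]) auto
  obtain a where a: "a \<in> hom Q P" "\<pi> \<cdot> a = \<omega>" "\<rho> \<cdot> a = q"
    by (rule pullback_pair[OF P d ck \<omega> pq(2) d\<omega>])
  note [simp] = homD[OF i'(1)] homD[OF s(1)] homD[OF a(1)] Comp_extend[OF a(2)] Comp_extend[OF a(3)]
  have ai: "a \<cdot> i = i'"
    by (rule pullback_unique[OF P, of _ X]) (auto intro: homI simp: i i' \<omega>i)
  have a_s: "a \<cdot> \<delta> = s"
    by (rule pullback_unique[OF P, of _ X]) (auto intro: homI simp: s \<delta> \<omega>\<delta>)
  have "is_iso C a"
    by (rule split_extension_comparison_iso[OF ext
      split_extension_of_pullback[OF kernel_d d ck P i' s(1,3)] a(1) ai a(3) a_s])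
  then obtain b where b: "b \<in> hom P Q" "b \<cdot> a = \<one> Q" using isoE[OF _ a(1)] by metis
  note [simp] = homD[OF b(1)]
  have "(b \<cdot> a) \<cdot> i = b \<cdot> i'" "(b \<cdot> a) \<cdot> \<delta> = b \<cdot> s" by (simp_all add: ai a_s)
  then have bi: "b \<cdot> i' = i" and bs: "b \<cdot> s = \<delta>" by (simp_all add: b(2))
  show ?thesis
    by (rule star_multiplicativeI[OF P Comp_in[OF b(1) pq(1)] i' s]) (simp_all add: bi bs i \<delta>)
qed

lemma huq_commute_imp_peiffer:
  assumes "huq_commute C X Y C\<^sub>1 k l"
  shows "peiffer C C\<^sub>1 c e X k"
proof -
  obtain P p q i j \<phi> where P: "is_product C X Y P p q" and \<phi>: "\<phi> \<in> hom P C\<^sub>1"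
    and i: "i \<in> hom X P" "p \<cdot> i = \<one> X" "q \<cdot> i = \<zero> X Y"
    and j: "j \<in> hom Y P" "p \<cdot> j = \<zero> Y X" "q \<cdot> j = \<one> Y"
    and \<phi>i: "\<phi> \<cdot> i = k" and \<phi>j: "\<phi> \<cdot> j = l"
    using huq_commuteE[OF assms] .
  note pq = productD[OF P]
  note ext = split_extension_of_product[OF product_sym[OF P] j(1,3,2) i(1,2)]
  obtain R \<pi> \<rho> where R: "is_pullback C c (c \<cdot> k) R \<pi> \<rho>" using pullback_exists[OF c ck] .
  note \<pi>\<rho> = pullbackD[OF R c ck]
  note [simp] = homD[OF \<pi>\<rho>(1)] homD[OF \<pi>\<rho>(2)] homD[OF pq(1)] homD[OF pq(2)] homD[OF \<phi>]
    homD[OF i(1)] homD[OF j(1)]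
  have c\<phi>: "c \<cdot> \<phi> = (c \<cdot> k) \<cdot> p"
    by (rule split_extension_jointly_epic[OF ext, of _ C\<^sub>0])
      (auto intro: homI simp: i j \<phi>i \<phi>j)
  have z: "\<zero> Y X \<in> hom Y X" by (auto intro: homI)
  obtain l' where l': "l' \<in> hom Y R" "\<pi> \<cdot> l' = l" "\<rho> \<cdot> l' = \<zero> Y X"
    by (rule pullback_pair[OF R c ck l z]) auto
  obtain k' where k': "k' \<in> hom X R" "\<pi> \<cdot> k' = k" "\<rho> \<cdot> k' = \<one> X"
    by (rule pullback_pair[OF R c ck k one_X]) auto
  obtain s where s: "s \<in> hom X R" "\<pi> \<cdot> s = e \<cdot> c \<cdot> k" "\<rho> \<cdot> s = \<one> X"
    by (rule pullback_pair[OF R c ck eck one_X]) auto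
  obtain a where a: "a \<in> hom P R" "\<pi> \<cdot> a = \<phi>" "\<rho> \<cdot> a = p"
    by (rule pullback_pair[OF R c ck \<phi> pq(1) c\<phi>])
  note [simp] = homD[OF l'(1)] homD[OF k'(1)] homD[OF s(1)] homD[OF a(1)]
    Comp_extend[OF a(2)] Comp_extend[OF a(3)]
  have aj: "a \<cdot> j = l'"
    by (rule pullback_unique[OF R, of _ Y]) (auto intro: homI simp: j l' \<phi>j)
  have ai: "a \<cdot> i = k'"
    by (rule pullback_unique[OF R, of _ X]) (auto intro: homI simp: i k' \<phi>i)
  have "is_iso C a"
    by (rule split_extension_comparison_iso[OF ext
      split_extension_of_pullback[OF kernel_c c ck R l' k'(1,3)] a(1) aj a(3) ai])
  then obtain b where b: "b \<in> hom R P" "a \<cdot> b = \<one> R" using isoE[OF _ a(1)] by metis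
  note [simp] = homD[OF b(1)]
  have \<phi>b: "\<phi> \<cdot> b = \<pi>" and pb: "p \<cdot> b = \<rho>"
    using Comp_assoc[OF b(1) a(1) \<pi>\<rho>(1)] Comp_assoc[OF b(1) a(1) \<pi>\<rho>(2)] by (simp_all add: a b(2))
  \<comment> \<open>\<open>b \<cdot> s = \<langle>1, t\<rangle>\<close> with \<open>\<phi> \<langle>1, t\<rangle> = e c k\<close>, so that \<open>\<omega> = \<phi> (1 \<times> t)\<close> works.\<close>
  define t where "t = q \<cdot> b \<cdot> s"
  have t: "t \<in> hom X Y" unfolding t_def by (auto intro: homI)
  note [simp] = homD[OF t]
  obtain Q p' q' where Q: "is_product C X X Q p' q'" by (rule product_exists[of X X]) auto
  note pq' = productD[OF Q]
  note [simp] = homD[OF pq'(1)] homD[OF pq'(2)]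
  obtain i' where i': "i' \<in> hom X Q" "p' \<cdot> i' = \<one> X" "q' \<cdot> i' = \<zero> X X"
    by (rule product_pair[OF Q one_X zero_X])
  obtain \<delta> where \<delta>: "\<delta> \<in> hom X Q" "p' \<cdot> \<delta> = \<one> X" "q' \<cdot> \<delta> = \<one> X"
    by (rule product_pair[OF Q one_X one_X])
  obtain f where f: "f \<in> hom Q P" "p \<cdot> f = p'" "q \<cdot> f = t \<cdot> q'"
    by (rule product_pair[OF P pq'(1) Comp_in[OF pq'(2) t]])
  note [simp] = homD[OF i'(1)] homD[OF \<delta>(1)] homD[OF f(1)] Comp_extend[OF f(2)] Comp_extend[OF f(3)]
  have fi: "f \<cdot> i' = i"
    by (rule product_unique[OF P, of _ X]) (auto intro: homI simp: i i')
  have f\<delta>: "f \<cdot> \<delta> = b \<cdot> s"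
    by (rule product_unique[OF P, of _ X]) (auto intro: homI simp: \<delta> s Comp_extend[OF pb] t_def)
  show ?thesis
    by (rule peifferI[OF Q Comp_in[OF f(1) \<phi>] i' \<delta>])
      (simp_all add: fi f\<delta> \<phi>i Comp_extend[OF \<phi>b] s)
qed

section \<open>Peiffer graphs have commuting kernels\<close>

text \<open>
  The images of \<open>c k\<close> and \<open>d l\<close> in \<open>C\<^sub>0\<close> coincide, because \<open>C\<close> generates a reflexive relation on
  \<open>C\<^sub>0\<close> and reflexive relations are symmetric in a protomodular category.  Concretely, let \<open>S\<close> be
  the object of triples \<open>(a, y, y')\<close> with \<open>d a = d l y\<close> and \<open>c a = d l y'\<close>.  The projection
  \<open>S \<rightarrow> Y \<times> Y\<close> hits \<open>(y, 0)\<close> through \<open>a = l y\<close> and \<open>(y, y)\<close> through \<open>a = e d l y\<close>, which generate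
  \<open>Y \<times> Y\<close>.  It is therefore a regular epimorphism, and so \<open>(0, y)\<close> is hit locally.
\<close>

lemma dl_locally_factors_through_ck:
  obtains V v x where "v \<in> hom V Y" "regular_epi C v" "x \<in> hom V X" "c \<cdot> k \<cdot> x = d \<cdot> l \<cdot> v"
proof -
  obtain Q q1 q2 where Q: "is_product C C\<^sub>0 C\<^sub>0 Q q1 q2" by (rule product_exists[of C\<^sub>0 C\<^sub>0]) auto
  note q = productD[OF Q]
  obtain M m1 m2 where M: "is_product C Y Y M m1 m2" by (rule product_exists[of Y Y]) auto
  note m = productD[OF M]
  have z: "\<zero> Y Y \<in> hom Y Y" and one: "\<one> Y \<in> hom Y Y" by (auto intro: homI)
  obtain g where g: "g \<in> hom C\<^sub>1 Q" "q1 \<cdot> g = d" "q2 \<cdot> g = c" by (rule product_pair[OF Q d c])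
  obtain h where h: "h \<in> hom M Q" "q1 \<cdot> h = (d \<cdot> l) \<cdot> m1" "q2 \<cdot> h = (d \<cdot> l) \<cdot> m2"
    by (rule product_pair[OF Q Comp_in[OF m(1) dl] Comp_in[OF m(2) dl]])
  obtain S a b where S: "is_pullback C g h S a b" using pullback_exists[OF g(1) h(1)] .
  note ab = pullbackD[OF S g(1) h(1)]
  obtain i where i: "i \<in> hom Y M" "m1 \<cdot> i = \<one> Y" "m2 \<cdot> i = \<zero> Y Y" by (rule product_pair[OF M one z])
  obtain \<delta> where \<delta>: "\<delta> \<in> hom Y M" "m1 \<cdot> \<delta> = \<one> Y" "m2 \<cdot> \<delta> = \<one> Y" by (rule product_pair[OF M one one])
  obtain j where j: "j \<in> hom Y M" "m1 \<cdot> j = \<zero> Y Y" "m2 \<cdot> j = \<one> Y" by (rule product_pair[OF M z one])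
  note [simp] = homD[OF q(1)] homD[OF q(2)] homD[OF m(1)] homD[OF m(2)] homD[OF g(1)] homD[OF h(1)]
    homD[OF ab(1)] homD[OF ab(2)] homD[OF i(1)] homD[OF \<delta>(1)] homD[OF j(1)]
  note [simp] = Comp_extend[OF g(2)] Comp_extend[OF g(3)] Comp_extend[OF h(2)] Comp_extend[OF h(3)]
  have gi: "g \<cdot> l = h \<cdot> i"
    by (rule product_unique[OF Q, of _ Y]) (auto intro: homI simp: i)
  have g\<delta>: "g \<cdot> e \<cdot> d \<cdot> l = h \<cdot> \<delta>"
    by (rule product_unique[OF Q, of _ Y]) (auto intro: homI simp: \<delta>)
  have edl: "e \<cdot> d \<cdot> l \<in> hom Y C\<^sub>1" by (auto intro: homI)
  obtain i' where i': "i' \<in> hom Y S" "b \<cdot> i' = i" by (rule pullback_pair[OF S g(1) h(1) l i(1) gi])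
  obtain s' where s': "s' \<in> hom Y S" "b \<cdot> s' = \<delta>" by (rule pullback_pair[OF S g(1) h(1) edl \<delta>(1) g\<delta>])
  have b_epi: "regular_epi C b"
    by (rule regular_epi_through_split_extension
      [OF split_extension_of_product[OF M i \<delta>(1,3)] ab(2) i' s'])
  obtain V u v where V: "is_pullback C b j V u v" using pullback_exists[OF ab(2) j(1)] .
  note uv = pullbackD[OF V ab(2) j(1)]
  note [simp] = homD[OF uv(1)] homD[OF uv(2)]
  have gau: "g \<cdot> a \<cdot> u = h \<cdot> j \<cdot> v"
    by (simp add: Comp_extend[OF ab(3)] uv(3))
  have "q1 \<cdot> (g \<cdot> a \<cdot> u) = q1 \<cdot> (h \<cdot> j \<cdot> v)" "q2 \<cdot> (g \<cdot> a \<cdot> u) = q2 \<cdot> (h \<cdot> j \<cdot> v)"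
    by (simp_all only: gau)
  then have dau: "d \<cdot> a \<cdot> u = \<zero> V C\<^sub>0" and cau: "c \<cdot> a \<cdot> u = d \<cdot> l \<cdot> v"
    by (simp_all add: Comp_extend[OF j(2)] Comp_extend[OF j(3)])
  obtain x where x: "x \<in> hom V X" "k \<cdot> x = a \<cdot> u"
    by (rule kernel_lift[OF kernel_d d Comp_in[OF uv(1) ab(1)] dau])
  show ?thesis
    by (rule that[OF uv(2) regular_epi_stable[OF b_epi V] x(1)]) (simp add: x cau)
qed

text \<open>
  Here \<open>t\<close> is the restriction of \<open>\<omega>\<close> to the second factor; for groups, \<open>t x = k(x)\<inverse> e c k(x)\<close>.
  On \<open>K = ker (c k)\<close>, which \<open>k\<close> embeds as the intersection of the two kernels, \<open>t\<close> is negation,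
  because \<open>\<omega>\<close> restricts to a subtraction on \<open>K\<close>.  Negation is invertible, and the same
  intersection, embedded by \<open>l\<close>, is \<open>ker (d l)\<close>.
\<close>

lemma peiffer_kernel_of_dl:
  assumes P: "is_product C X X P p q" and \<omega>: "\<omega> \<in> hom P C\<^sub>1"
    and i: "i \<in> hom X P" "p \<cdot> i = \<one> X" "q \<cdot> i = \<zero> X X"
    and \<delta>: "\<delta> \<in> hom X P" "p \<cdot> \<delta> = \<one> X" "q \<cdot> \<delta> = \<one> X"
    and j: "j \<in> hom X P" "p \<cdot> j = \<zero> X X" "q \<cdot> j = \<one> X"
    and \<omega>i: "\<omega> \<cdot> i = k" and \<omega>\<delta>: "\<omega> \<cdot> \<delta> = e \<cdot> c \<cdot> k"
    and c\<omega>: "c \<cdot> \<omega> = c \<cdot> k \<cdot> p" and d\<omega>: "d \<cdot> \<omega> = c \<cdot> k \<cdot> q"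
    and t: "t \<in> hom X Y" "l \<cdot> t = \<omega> \<cdot> j"
    and K: "is_kernel C (c \<cdot> k) K \<kappa>"
  shows "is_kernel C (d \<cdot> l) K (t \<cdot> \<kappa>)"
proof -
  note pq = productD[OF P] and \<kappa> = kernelD[OF K ck]
  have ck\<kappa>: "c \<cdot> k \<cdot> \<kappa> = \<zero> K C\<^sub>0" using \<kappa> homD[OF \<kappa>(1)] by simp
  note [simp] = homD[OF pq(1)] homD[OF pq(2)] homD[OF \<omega>] homD[OF i(1)] homD[OF \<delta>(1)] homD[OF j(1)]
    homD[OF t(1)] homD[OF \<kappa>(1)]
  note [simp] = Comp_extend[OF i(2)] Comp_extend[OF i(3)] Comp_extend[OF \<delta>(2)] Comp_extend[OF \<delta>(3)]
    Comp_extend[OF j(2)] Comp_extend[OF j(3)] Comp_extend[OF \<omega>i] Comp_extend[OF \<omega>\<delta>]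
    Comp_extend[OF c\<omega>] Comp_extend[OF d\<omega>] Comp_extend[OF t(2)] c\<omega> d\<omega>
  have k\<kappa>_cancel: "u = v" if "u \<in> hom T K" "v \<in> hom T K" "k \<cdot> \<kappa> \<cdot> u = k \<cdot> \<kappa> \<cdot> v" for u v T
    using monicD[OF kernel_monic[OF K] \<kappa>(1) that(1,2)]
      monicD[OF kernel_monic[OF kernel_d] k Comp_in[OF that(1) \<kappa>(1)] Comp_in[OF that(2) \<kappa>(1)] that(3)]
    by simp
  have k\<kappa>_lift: "\<exists>w \<in> hom T K. k \<cdot> \<kappa> \<cdot> w = u"
    if u: "u \<in> hom T C\<^sub>1" "d \<cdot> u = \<zero> T C\<^sub>0" "c \<cdot> u = \<zero> T C\<^sub>0" for u T
  proof -
    obtain v where v: "v \<in> hom T X" "k \<cdot> v = u" by (rule kernel_lift[OF kernel_d d u(1,2)])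
    note [simp] = homD[OF v(1)]
    obtain w where w: "w \<in> hom T K" "\<kappa> \<cdot> w = v"
      by (rule kernel_lift[OF K ck v(1)]) (simp_all add: v u)
    with v show ?thesis by auto
  qed
  obtain M m1 m2 where M: "is_product C K K M m1 m2" by (rule product_exists[of K K]) auto
  note m = productD[OF M]
  note [simp] = homD[OF m(1)] homD[OF m(2)]
  have z: "\<zero> K K \<in> hom K K" and one: "\<one> K \<in> hom K K" by (auto intro: homI)
  obtain i' where i': "i' \<in> hom K M" "m1 \<cdot> i' = \<one> K" "m2 \<cdot> i' = \<zero> K K" by (rule product_pair[OF M one z])
  obtain \<delta>' where \<delta>': "\<delta>' \<in> hom K M" "m1 \<cdot> \<delta>' = \<one> K" "m2 \<cdot> \<delta>' = \<one> K" by (rule product_pair[OF M one one])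
  obtain j' where j': "j' \<in> hom K M" "m1 \<cdot> j' = \<zero> K K" "m2 \<cdot> j' = \<one> K" by (rule product_pair[OF M z one])
  obtain f where f: "f \<in> hom M P" "p \<cdot> f = \<kappa> \<cdot> m1" "q \<cdot> f = \<kappa> \<cdot> m2"
    by (rule product_pair[OF P Comp_in[OF m(1) \<kappa>(1)] Comp_in[OF m(2) \<kappa>(1)]])
  note [simp] = homD[OF i'(1)] homD[OF \<delta>'(1)] homD[OF j'(1)] homD[OF f(1)]
    Comp_extend[OF f(2)] Comp_extend[OF f(3)]
  have fi: "f \<cdot> i' = i \<cdot> \<kappa>"
    by (rule product_unique[OF P, of _ K]) (auto intro: homI simp: i')
  have f\<delta>: "f \<cdot> \<delta>' = \<delta> \<cdot> \<kappa>"
    by (rule product_unique[OF P, of _ K]) (auto intro: homI simp: \<delta>')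
  have fj: "f \<cdot> j' = j \<cdot> \<kappa>"
    by (rule product_unique[OF P, of _ K]) (auto intro: homI simp: j')
  have "\<exists>n \<in> hom M K. k \<cdot> \<kappa> \<cdot> n = \<omega> \<cdot> f"
    by (rule k\<kappa>_lift) (auto intro: homI simp: f Comp_extend3[OF ck\<kappa>])
  then obtain n where n: "n \<in> hom M K" "k \<cdot> \<kappa> \<cdot> n = \<omega> \<cdot> f" by auto
  note [simp] = homD[OF n(1)]
  have ni: "n \<cdot> i' = \<one> K"
    by (rule k\<kappa>_cancel[of _ K]) (auto intro: homI simp: Comp_extend3[OF n(2)] fi)
  have n\<delta>: "n \<cdot> \<delta>' = \<zero> K K"
    by (rule k\<kappa>_cancel[of _ K]) (auto intro: homI simp: Comp_extend3[OF n(2)] f\<delta> ck\<kappa>)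
  define neg where "neg = n \<cdot> j'"
  have neg: "neg \<in> hom K K" unfolding neg_def by (auto intro: homI)
  note [simp] = homD[OF neg]
  have neg_neg: "neg \<cdot> neg = \<one> K"
    unfolding neg_def by (rule subtraction_negation_involutive[OF M n(1) i' ni \<delta>' n\<delta> j'])
  have \<omega>j\<kappa>: "\<omega> \<cdot> j \<cdot> \<kappa> = k \<cdot> \<kappa> \<cdot> neg"
    unfolding neg_def by (simp add: Comp_extend3[OF n(2)] fj)
  show ?thesis
  proof (rule kernelI[OF dl])
    show "t \<cdot> \<kappa> \<in> hom K Y" by (auto intro: homI)
    show "(d \<cdot> l) \<cdot> (t \<cdot> \<kappa>) = \<zero> K C\<^sub>0" by (simp add: ck\<kappa>)
    have "u = v" if uv: "u \<in> hom T K" "v \<in> hom T K" "(t \<cdot> \<kappa>) \<cdot> u = (t \<cdot> \<kappa>) \<cdot> v" for T u v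
    proof -
      note [simp] = homD[OF uv(1)] homD[OF uv(2)]
      have "l \<cdot> ((t \<cdot> \<kappa>) \<cdot> u) = l \<cdot> ((t \<cdot> \<kappa>) \<cdot> v)" by (simp only: uv(3))
      then have "k \<cdot> \<kappa> \<cdot> neg \<cdot> u = k \<cdot> \<kappa> \<cdot> neg \<cdot> v" by (simp add: Comp_extend3[OF \<omega>j\<kappa>])
      then have "neg \<cdot> u = neg \<cdot> v" by (rule k\<kappa>_cancel[rotated -1]) (auto intro: homI)
      then have "neg \<cdot> (neg \<cdot> u) = neg \<cdot> (neg \<cdot> v)" by simp
      then show ?thesis by (simp add: Comp_extend[OF neg_neg])
    qed
    then show "monic (t \<cdot> \<kappa>)" unfolding monic_def by auto
    fix T u assume u: "u \<in> hom T Y" "(d \<cdot> l) \<cdot> u = \<zero> T C\<^sub>0"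
    note [simp] = homD[OF u(1)]
    have "\<exists>w \<in> hom T K. k \<cdot> \<kappa> \<cdot> w = l \<cdot> u"
      by (rule k\<kappa>_lift) (use u in \<open>auto intro: homI\<close>)
    then obtain w where w: "w \<in> hom T K" "k \<cdot> \<kappa> \<cdot> w = l \<cdot> u" by auto
    note [simp] = homD[OF w(1)]
    have nw: "neg \<cdot> w \<in> hom T K" by (auto intro: homI)
    have "(t \<cdot> \<kappa>) \<cdot> (neg \<cdot> w) = u"
    proof (rule monicD[OF kernel_monic[OF kernel_c] l, of _ T])
      show "l \<cdot> (t \<cdot> \<kappa>) \<cdot> neg \<cdot> w = l \<cdot> u"
        by (simp add: Comp_extend3[OF \<omega>j\<kappa>] Comp_extend[OF neg_neg] w)
    qed (use u in \<open>auto intro: homI\<close>)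
    with nw show "\<exists>w \<in> hom T K. (t \<cdot> \<kappa>) \<cdot> w = u" by blast
  qed
qed

lemma peiffer_imp_huq_commute:
  assumes "peiffer C C\<^sub>1 c e X k"
  shows "huq_commute C X Y C\<^sub>1 k l"
proof -
  obtain P p q i \<delta> \<omega> where P: "is_product C X X P p q" and \<omega>: "\<omega> \<in> hom P C\<^sub>1"
    and i: "i \<in> hom X P" "p \<cdot> i = \<one> X" "q \<cdot> i = \<zero> X X"
    and \<delta>: "\<delta> \<in> hom X P" "p \<cdot> \<delta> = \<one> X" "q \<cdot> \<delta> = \<one> X"
    and \<omega>i: "\<omega> \<cdot> i = k" and \<omega>\<delta>: "\<omega> \<cdot> \<delta> = e \<cdot> c \<cdot> k"
    using peifferE[OF assms] .
  note pq = productD[OF P]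
  note ext = split_extension_of_product[OF P i \<delta>(1,3)]
  obtain j where j: "j \<in> hom X P" "p \<cdot> j = \<zero> X X" "q \<cdot> j = \<one> X"
    by (rule product_pair[OF P zero_X one_X])
  note [simp] = homD[OF pq(1)] homD[OF pq(2)] homD[OF \<omega>] homD[OF i(1)] homD[OF \<delta>(1)] homD[OF j(1)]
  have c\<omega>: "c \<cdot> \<omega> = c \<cdot> k \<cdot> p" and d\<omega>: "d \<cdot> \<omega> = c \<cdot> k \<cdot> q"
    by (rule split_extension_jointly_epic[OF ext, of _ C\<^sub>0];
      force intro: homI simp: i \<delta> \<omega>i \<omega>\<delta>)+
  have "c \<cdot> (\<omega> \<cdot> j) = \<zero> X C\<^sub>0" by (simp add: Comp_extend[OF c\<omega>] j)
  then obtain t where t: "t \<in> hom X Y" "l \<cdot> t = \<omega> \<cdot> j"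
    by (rule kernel_lift[OF kernel_c c Comp_in[OF j(1) \<omega>]])
  note [simp] = homD[OF t(1)]
  have dlt: "d \<cdot> l \<cdot> t = c \<cdot> k" by (simp add: t Comp_extend[OF d\<omega>] j)
  obtain K \<kappa> where K: "is_kernel C (c \<cdot> k) K \<kappa>" using kernel_exists[OF ck] .
  note \<kappa> = kernelD[OF K ck]
  have ker_dl: "is_kernel C (d \<cdot> l) K (t \<cdot> \<kappa>)"
    by (rule peiffer_kernel_of_dl[OF P \<omega> i \<delta> j \<omega>i \<omega>\<delta> c\<omega> d\<omega> t K])
  \<comment> \<open>The pullbacks \<open>E\<close> of \<open>c k\<close> and \<open>T\<close> of \<open>d l\<close>, both along \<open>c k\<close>, are split extensions of \<open>X\<close>
    by \<open>K\<close>, with sections \<open>\<langle>1, 1\<rangle>\<close> and \<open>\<langle>t, 1\<rangle>\<close>; \<open>g\<close> sends \<open>(x', x)\<close> to \<open>(t x', x)\<close>.\<close>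
  obtain E e1 e2 where E: "is_pullback C (c \<cdot> k) (c \<cdot> k) E e1 e2" using pullback_exists[OF ck ck] .
  note e12 = pullbackD[OF E ck ck]
  obtain T \<tau> \<xi> where T: "is_pullback C (d \<cdot> l) (c \<cdot> k) T \<tau> \<xi>" using pullback_exists[OF dl ck] .
  note \<tau>\<xi> = pullbackD[OF T dl ck]
  note [simp] = homD[OF \<kappa>(1)] homD[OF e12(1)] homD[OF e12(2)] homD[OF \<tau>\<xi>(1)] homD[OF \<tau>\<xi>(2)]
  have ck\<kappa>: "c \<cdot> k \<cdot> \<kappa> = \<zero> K C\<^sub>0" using \<kappa>(2) by simp
  have z: "\<zero> K X \<in> hom K X" by (auto intro: homI)
  have t\<kappa>: "t \<cdot> \<kappa> \<in> hom K Y" by (auto intro: homI)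
  obtain iE where iE: "iE \<in> hom K E" "e1 \<cdot> iE = \<kappa>" "e2 \<cdot> iE = \<zero> K X"
    by (rule pullback_pair[OF E ck ck \<kappa>(1) z]) (auto simp: ck\<kappa>)
  obtain sE where sE: "sE \<in> hom X E" "e1 \<cdot> sE = \<one> X" "e2 \<cdot> sE = \<one> X"
    by (rule pullback_pair[OF E ck ck one_X one_X]) auto
  obtain iT where iT: "iT \<in> hom K T" "\<tau> \<cdot> iT = t \<cdot> \<kappa>" "\<xi> \<cdot> iT = \<zero> K X"
    by (rule pullback_pair[OF T dl ck t\<kappa> z]) (auto simp: Comp_extend3[OF dlt] ck\<kappa>)
  obtain sT where sT: "sT \<in> hom X T" "\<tau> \<cdot> sT = t" "\<xi> \<cdot> sT = \<one> X"
    by (rule pullback_pair[OF T dl ck t(1) one_X]) (auto simp: dlt)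
  obtain g where g: "g \<in> hom E T" "\<tau> \<cdot> g = t \<cdot> e1" "\<xi> \<cdot> g = e2"
    by (rule pullback_pair[OF T dl ck Comp_in[OF e12(1) t(1)] e12(2)])
      (use e12(3) in \<open>auto simp: Comp_extend3[OF dlt]\<close>)
  note [simp] = homD[OF iE(1)] homD[OF sE(1)] homD[OF iT(1)] homD[OF sT(1)] homD[OF g(1)]
    Comp_extend[OF g(2)] Comp_extend[OF g(3)]
  have gi: "g \<cdot> iE = iT"
    by (rule pullback_unique[OF T, of _ K]) (auto intro: homI simp: iE iT)
  have gs: "g \<cdot> sE = sT"
    by (rule pullback_unique[OF T, of _ X]) (auto intro: homI simp: sE sT)
  have "is_iso C g"
    by (rule split_extension_comparison_iso[OF split_extension_of_pullback[OF K ck ck E iE sE(1,3)]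
      split_extension_of_pullback[OF ker_dl dl ck T iT sT(1,3)] g(1) gi g(3) gs])
  then obtain g' where g': "g' \<in> hom T E" "g' \<cdot> g = \<one> E" "g \<cdot> g' = \<one> T" using isoE[OF _ g(1)] by metis
  note [simp] = homD[OF g'(1)]
  \<comment> \<open>If \<open>t u = t v\<close>, then \<open>g\<close> identifies the points \<open>(u, v)\<close> and \<open>(v, v)\<close> of \<open>E\<close>.\<close>
  have "u = v" if uv: "u \<in> hom W X" "v \<in> hom W X" "t \<cdot> u = t \<cdot> v" for W u v
  proof -
    note [simp] = homD[OF uv(1)] homD[OF uv(2)]
    have "c \<cdot> k \<cdot> u = d \<cdot> l \<cdot> t \<cdot> u" by (simp add: Comp_extend3[OF dlt])
    also have "\<dots> = c \<cdot> k \<cdot> v" by (simp add: uv(3) Comp_extend3[OF dlt])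
    finally have ckuv: "c \<cdot> k \<cdot> u = c \<cdot> k \<cdot> v" .
    obtain w where w: "w \<in> hom W E" "e1 \<cdot> w = u" "e2 \<cdot> w = v"
      by (rule pullback_pair[OF E ck ck uv(1,2)]) (simp_all add: ckuv)
    obtain w' where w': "w' \<in> hom W E" "e1 \<cdot> w' = v" "e2 \<cdot> w' = v"
      by (rule pullback_pair[OF E ck ck uv(2,2)]) simp_all
    note [simp] = homD[OF w(1)] homD[OF w'(1)]
    have gw: "g \<cdot> w = g \<cdot> w'"
      by (rule pullback_unique[OF T, of _ W]) (auto intro: homI simp: w w' uv(3))
    have "g' \<cdot> (g \<cdot> w) = g' \<cdot> (g \<cdot> w')" by (simp only: gw)
    then have "w = w'" by (simp add: Comp_extend[OF g'(2)])
    then show ?thesis using w w' by simp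
  qed
  then have t_monic: "monic t" unfolding monic_def by auto
  obtain V v x where v: "v \<in> hom V Y" "regular_epi C v" and x: "x \<in> hom V X" "c \<cdot> k \<cdot> x = d \<cdot> l \<cdot> v"
    using dl_locally_factors_through_ck .
  note [simp] = homD[OF v(1)] homD[OF x(1)]
  obtain w where w: "w \<in> hom V T" "\<tau> \<cdot> w = v" "\<xi> \<cdot> w = x"
    by (rule pullback_pair[OF T dl ck v(1) x(1)]) (simp_all add: x)
  note [simp] = homD[OF w(1)]
  \<comment> \<open>Transporting \<open>(v, x)\<close> from \<open>T\<close> to \<open>E\<close> exhibits \<open>v\<close> as a composite through \<open>t\<close>.\<close>
  have "\<tau> \<cdot> ((g \<cdot> g') \<cdot> w) = t \<cdot> e1 \<cdot> g' \<cdot> w" by simp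
  then have "v = t \<cdot> (e1 \<cdot> g' \<cdot> w)" by (simp add: g' w)
  moreover have "e1 \<cdot> g' \<cdot> w \<in> hom V X" by (auto intro: homI)
  ultimately have "is_iso C t" using monic_regular_epi_iso[OF t_monic t(1)] v(2) by metis
  then obtain t' where t': "t' \<in> hom Y X" "t \<cdot> t' = \<one> Y" using isoE[OF _ t(1)] by metis
  note [simp] = homD[OF t'(1)]
  \<comment> \<open>The arrow \<open>f\<close> is \<open>1 \<times> t\<inverse>\<close>, and \<open>\<omega> \<cdot> f\<close> shows that \<open>k\<close> and \<open>l\<close> commute.\<close>
  obtain Q p' q' where Q: "is_product C X Y Q p' q'" by (rule product_exists[of X Y]) auto
  note pq' = productD[OF Q]
  note [simp] = homD[OF pq'(1)] homD[OF pq'(2)]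
  have z': "\<zero> X Y \<in> hom X Y" "\<zero> Y X \<in> hom Y X" "\<one> Y \<in> hom Y Y" by (auto intro: homI)
  obtain i' where i': "i' \<in> hom X Q" "p' \<cdot> i' = \<one> X" "q' \<cdot> i' = \<zero> X Y"
    by (rule product_pair[OF Q one_X z'(1)])
  obtain j' where j': "j' \<in> hom Y Q" "p' \<cdot> j' = \<zero> Y X" "q' \<cdot> j' = \<one> Y"
    by (rule product_pair[OF Q z'(2,3)])
  obtain f where f: "f \<in> hom Q P" "p \<cdot> f = p'" "q \<cdot> f = t' \<cdot> q'"
    by (rule product_pair[OF P pq'(1) Comp_in[OF pq'(2) t'(1)]])
  note [simp] = homD[OF i'(1)] homD[OF j'(1)] homD[OF f(1)] Comp_extend[OF f(2)] Comp_extend[OF f(3)]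
  have fi: "f \<cdot> i' = i"
    by (rule product_unique[OF P, of _ X]) (auto intro: homI simp: i i')
  have fj: "f \<cdot> j' = j \<cdot> t'"
    by (rule product_unique[OF P, of _ Y])
      (auto intro: homI simp: j' Comp_extend[OF j(2)] Comp_extend[OF j(3)])
  have "\<omega> \<cdot> j \<cdot> t' = l \<cdot> t \<cdot> t'" using Comp_extend[OF t(2)] by simp
  then show ?thesis
    by (intro huq_commuteI[OF Q Comp_in[OF f(1) \<omega>] i' j']) (simp_all add: fi fj \<omega>i t')
qed

end

theorem proposition2p10:
  fixes C :: "('o, 'm, 'x) cat_scheme"
    and C\<^sub>1 C\<^sub>0 X Y :: 'o
    and d c e k l :: 'm
  assumes "semi_abelian_category C"
    and "reflexive_graph C C\<^sub>1 C\<^sub>0 d c e"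
    and "is_kernel C d X k"
    and "is_kernel C c Y l"
  shows "(star_multiplicative C d c e X k \<longleftrightarrow> peiffer C C\<^sub>1 c e X k) \<and>
    (peiffer C C\<^sub>1 c e X k \<longleftrightarrow> huq_commute C X Y C\<^sub>1 k l)"
proof -
  interpret semi_abelian_category C by fact
  interpret reflexive_graph_with_kernels C C\<^sub>1 C\<^sub>0 X Y d c e k l
    by unfold_locales fact+
  show ?thesis
    using star_multiplicative_imp_peiffer peiffer_imp_star_multiplicative
      peiffer_imp_huq_commute huq_commute_imp_peiffer by blast
qed

end
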